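(* If $(X,d)$ is an infinite compact quasihypermetric space, then the topology of $E_0(X)$ and the weak-$*$ topology on $\mathcal{M}_0(X)$ are incomparable, that is, neither of these two topologies on the set $\mathcal{M}_0(X)$ is contained in the other.
   Context: A metric space $(X,d)$ is called quasihypermetric if for all $n\in\mathbb{N}$, all $\alpha_1,\dots,\alpha_n\in\mathbb{R}$ with $\sum_{i=1}^n\alpha_i=0$ and all $x_1,\dots,x_n\in X$ one has $\sum_{i,j=1}^n\alpha_i\alpha_j d(x_i,x_j)\le 0$. For a compact metric space $(X,d)$, $\mathcal{M}(X)$ is the space of all finite signed Borel measures on $X$ and $\mathcal{M}_0(X)$ is the subspace of measures of total mass $0$. For $\mu,\nu\in\mathcal{M}(X)$, $I(\mu,\nu)=\int_X\int_X d(x,y)\,d\mu(x)\,d\nu(y)$ and $I(\mu)=I(\mu,\mu)$. When $(X,d)$ is compact quasihypermetric, $(\mu\mid\nu)=-I(\mu,\nu)$ is a semi-inner product (symmetric, positive semidefinite bilinear form) on $\mathcal{M}_0(X)$; $E_0(X)$ denotes $\mathcal{M}_0(X)$ with this semi-inner product, and its topology is the one induced by the seminorm $\|\mu\|=[-I(\mu)]^{1/2}$. The weak-$*$ topology on $\mathcal{M}(X)$ is the one in which a net $\mu_\alpha\to\mu$ iff $\int_X f\,d\mu_\alpha\to\int_X f\,d\mu$ for all real-valued continuous functions $f$ on $X$; the weak-$*$ topology on $\mathcal{M}_0(X)$ is its subspace topology. *)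

theory Defs
  imports "HOL-Analysis.Analysis"
begin

section \<open>Finite signed measures\<close>

definition borel_of :: "'a topology \<Rightarrow> 'a measure" where
  "borel_of T = sigma (topspace T) {U. openin T U}"

text \<open>
  A finite signed measure on the measurable space underlying \<open>M\<close> is a real-valued countably
  additive set function on \<open>sets M\<close>. Off \<open>sets M\<close> it is set to 0, so that signed measures are
  equal as functions iff they agree on all measurable sets.
\<close>
definition signed_measures :: "'a measure \<Rightarrow> ('a set \<Rightarrow> real) set" where
  "signed_measures M = {\<mu>.
     \<mu> {} = 0 \<and>
     (\<forall>A :: nat \<Rightarrow> 'a set. range A \<subseteq> sets M \<longrightarrow> disjoint_family A \<longrightarrow>
        (\<lambda>i. \<mu> (A i)) sums \<mu> (\<Union>i. A i)) \<and>
     (\<forall>A. A \<notin> sets M \<longrightarrow> \<mu> A = 0)}"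

definition null_mass_measures :: "'a measure \<Rightarrow> ('a set \<Rightarrow> real) set" where
  "null_mass_measures M = {\<mu> \<in> signed_measures M. \<mu> (space M) = 0}"

text \<open>
  The upper variation \<open>\<mu>\<^sup>+(A) = sup {\<mu>(B) | B \<subseteq> A measurable}\<close> of the Jordan decomposition; the
  lower variation is the upper variation of \<open>- \<mu>\<close>. The truncation at 0 in \<open>ennreal (\<mu> B)\<close> is
  harmless, because \<open>B = {}\<close> contributes the value 0.
\<close>
definition upper_variation :: "'a measure \<Rightarrow> ('a set \<Rightarrow> real) \<Rightarrow> 'a measure" where
  "upper_variation M \<mu> =
     measure_of (space M) (sets M) (\<lambda>A. SUP B \<in> {B \<in> sets M. B \<subseteq> A}. ennreal (\<mu> B))"

definition signed_integral :: "'a measure \<Rightarrow> ('a set \<Rightarrow> real) \<Rightarrow> ('a \<Rightarrow> real) \<Rightarrow> real" where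
  "signed_integral M \<mu> f =
     (\<integral>x. f x \<partial>upper_variation M \<mu>) - (\<integral>x. f x \<partial>upper_variation M (\<lambda>A. - \<mu> A))"


section \<open>The weak-star topology\<close>

definition weak_star :: "'a topology \<Rightarrow> ('a set \<Rightarrow> real) topology" where
  "weak_star T = topology_generated_by
     {{\<mu> \<in> signed_measures (borel_of T). signed_integral (borel_of T) \<mu> f \<in> U} | f U.
        continuous_map T euclideanreal f \<and> open U}"

lemma topspace_weak_star: "topspace (weak_star T) = signed_measures (borel_of T)"
proof -
  have "continuous_map T euclideanreal (\<lambda>x. 0)" by simp
  then show ?thesis
    unfolding weak_star_def topology_generated_by_topspace by blast
qed

text \<open>Convergence of nets, in the language of filters, is convergence of all integrals.\<close>
lemma limitin_weak_star:
  "limitin (weak_star T) \<mu> \<nu> F \<longleftrightarrow>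
     \<nu> \<in> signed_measures (borel_of T) \<and>
     (\<forall>\<^sub>F a in F. \<mu> a \<in> signed_measures (borel_of T)) \<and>
     (\<forall>f. continuous_map T euclideanreal f \<longrightarrow>
        ((\<lambda>a. signed_integral (borel_of T) (\<mu> a) f) \<longlongrightarrow> signed_integral (borel_of T) \<nu> f) F)"
  (is "?L \<longleftrightarrow> ?R")
proof
  let ?M = "signed_measures (borel_of T)" and ?I = "signed_integral (borel_of T)"
  assume L: ?L
  then have "\<nu> \<in> ?M" by (simp add: limitin_def topspace_weak_star)
  moreover have "\<forall>\<^sub>F a in F. \<mu> a \<in> ?M"
    using L openin_topspace[of "weak_star T"] by (auto simp: limitin_def topspace_weak_star)
  moreover have "((\<lambda>a. ?I (\<mu> a) f) \<longlongrightarrow> ?I \<nu> f) F" if f: "continuous_map T euclideanreal f" for f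
  proof (rule topological_tendstoI)
    fix U :: "real set" assume U: "open U" "?I \<nu> f \<in> U"
    have "openin (weak_star T) {\<mu> \<in> ?M. ?I \<mu> f \<in> U}"
      unfolding weak_star_def using f U by (intro topology_generated_by_Basis) blast
    with L U \<open>\<nu> \<in> ?M\<close> have "\<forall>\<^sub>F a in F. \<mu> a \<in> {\<mu> \<in> ?M. ?I \<mu> f \<in> U}"
      unfolding limitin_def by blast
    then show "\<forall>\<^sub>F a in F. ?I (\<mu> a) f \<in> U" by (rule eventually_mono) blast
  qed
  ultimately show ?R by blast
next
  let ?M = "signed_measures (borel_of T)" and ?I = "signed_integral (borel_of T)"
  let ?B = "{{\<mu> \<in> ?M. ?I \<mu> f \<in> U} | f U. continuous_map T euclideanreal f \<and> open U}"
  assume R: ?R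
  have "\<nu> \<in> W \<longrightarrow> (\<forall>\<^sub>F a in F. \<mu> a \<in> W)" if "generate_topology_on ?B W" for W
    using that
  proof induction
    case Empty then show ?case by simp
  next
    case (Int a b) then show ?case by (auto intro: eventually_conj)
  next
    case (UN K)
    show ?case
    proof
      assume "\<nu> \<in> \<Union>K"
      then obtain k where "k \<in> K" "\<nu> \<in> k" by blast
      with UN have "\<forall>\<^sub>F a in F. \<mu> a \<in> k" by blast
      then show "\<forall>\<^sub>F a in F. \<mu> a \<in> \<Union>K" by (rule eventually_mono) (use \<open>k \<in> K\<close> in blast)
    qed
  next
    case (Basis s)
    then obtain f U where s: "s = {\<mu> \<in> ?M. ?I \<mu> f \<in> U}"
      and fU: "continuous_map T euclideanreal f" "open U" by blast
    show ?case
    proof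
      assume "\<nu> \<in> s"
      then have "?I \<nu> f \<in> U" by (simp add: s)
      then have "\<forall>\<^sub>F a in F. ?I (\<mu> a) f \<in> U"
        using R fU topological_tendstoD by blast
      with R show "\<forall>\<^sub>F a in F. \<mu> a \<in> s" by (auto simp: s intro: eventually_conj)
    qed
  qed
  with R show ?L
    unfolding limitin_def topspace_weak_star
    by (auto simp: weak_star_def openin_topology_generated_by_iff)
qed


section \<open>Quasihypermetric spaces and the energy seminorm\<close>

context Metric_space
begin

definition quasihypermetric :: bool where
  "quasihypermetric \<longleftrightarrow>
     (\<forall>(n::nat) (\<alpha> :: nat \<Rightarrow> real) (x :: nat \<Rightarrow> 'a).
        (\<Sum>i=1..n. \<alpha> i) = 0 \<longrightarrow> (\<forall>i\<in>{1..n}. x i \<in> M) \<longrightarrow>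
        (\<Sum>i=1..n. \<Sum>j=1..n. \<alpha> i * \<alpha> j * d (x i) (x j)) \<le> 0)"

abbreviation borel_sets :: "'a measure" where
  "borel_sets \<equiv> borel_of mtopology"

definition energy :: "('a set \<Rightarrow> real) \<Rightarrow> ('a set \<Rightarrow> real) \<Rightarrow> real" where
  "energy \<mu> \<nu> =
     signed_integral borel_sets \<nu> (\<lambda>y. signed_integral borel_sets \<mu> (\<lambda>x. d x y))"

definition energy_norm :: "('a set \<Rightarrow> real) \<Rightarrow> real" where
  "energy_norm \<mu> = sqrt (- energy \<mu> \<mu>)"

definition E0_topology :: "('a set \<Rightarrow> real) topology" where
  "E0_topology = topology (\<lambda>U. U \<subseteq> null_mass_measures borel_sets \<and>
     (\<forall>\<mu>\<in>U. \<exists>\<epsilon>>0. \<forall>\<nu>\<in>null_mass_measures borel_sets.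
        energy_norm (\<lambda>A. \<nu> A - \<mu> A) < \<epsilon> \<longrightarrow> \<nu> \<in> U))"

lemma openin_E0_topology:
  "openin E0_topology U \<longleftrightarrow>
     U \<subseteq> null_mass_measures borel_sets \<and>
     (\<forall>\<mu>\<in>U. \<exists>\<epsilon>>0. \<forall>\<nu>\<in>null_mass_measures borel_sets.
        energy_norm (\<lambda>A. \<nu> A - \<mu> A) < \<epsilon> \<longrightarrow> \<nu> \<in> U)"
proof -
  let ?N = "null_mass_measures borel_sets"
  let ?P = "\<lambda>U \<mu> \<epsilon>. \<forall>\<nu>\<in>?N. energy_norm (\<lambda>A. \<nu> A - \<mu> A) < \<epsilon> \<longrightarrow> \<nu> \<in> U"
  have "istopology (\<lambda>U. U \<subseteq> ?N \<and> (\<forall>\<mu>\<in>U. \<exists>\<epsilon>>0. ?P U \<mu> \<epsilon>))"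
    unfolding istopology_def
  proof (intro conjI allI impI ballI)
    fix S T \<mu>
    assume S: "S \<subseteq> ?N \<and> (\<forall>\<mu>\<in>S. \<exists>\<epsilon>>0. ?P S \<mu> \<epsilon>)"
      and T: "T \<subseteq> ?N \<and> (\<forall>\<mu>\<in>T. \<exists>\<epsilon>>0. ?P T \<mu> \<epsilon>)"
    show "S \<inter> T \<subseteq> ?N" using S by blast
    assume \<mu>: "\<mu> \<in> S \<inter> T"
    with S obtain e1 where e1: "e1 > 0" "?P S \<mu> e1" by blast
    from \<mu> T obtain e2 where e2: "e2 > 0" "?P T \<mu> e2" by blast
    have "min e1 e2 > 0" "?P (S \<inter> T) \<mu> (min e1 e2)" using e1 e2 by auto
    then show "\<exists>\<epsilon>>0. ?P (S \<inter> T) \<mu> \<epsilon>" by blast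
  next
    fix K
    assume K: "\<forall>S\<in>K. S \<subseteq> ?N \<and> (\<forall>\<mu>\<in>S. \<exists>\<epsilon>>0. ?P S \<mu> \<epsilon>)"
    then show "\<Union>K \<subseteq> ?N" by blast
    fix \<mu> assume "\<mu> \<in> \<Union>K"
    then obtain S where S: "S \<in> K" "\<mu> \<in> S" by blast
    with K obtain e where "e > 0" "?P S \<mu> e" by blast
    with S show "\<exists>\<epsilon>>0. ?P (\<Union>K) \<mu> \<epsilon>" by blast
  qed
  then show ?thesis unfolding E0_topology_def by (simp add: topology_inverse')
qed

definition weak_star_M0 :: "('a set \<Rightarrow> real) topology" where
  "weak_star_M0 = subtopology (weak_star mtopology) (null_mass_measures borel_sets)"

end

end

theory Submission
  imports Defs
begin

text \<open>
  Both directions rest on the dipoles \<open>\<delta>\<^bsub>y\<^esub> - \<delta>\<^bsub>x\<^esub>\<close> at an accumulation point \<open>x\<close>, whose energy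
  norm is \<open>sqrt (2 * d y x)\<close>. Scaled by \<open>d y x powr (- 1/4)\<close> they tend to 0 in energy norm, but not
  weak-star, as the test function \<open>\<lambda>y. d y x powr (1/4)\<close> shows. Conversely, if \<open>p k\<close> converges to \<open>x\<close> so fast that the normalized dipoles at \<open>p k\<close> are
  almost orthonormal, then these span an infinite-dimensional space on which the energy norm is
  a norm. A weak-star neighbourhood of 0 contains a subspace of finite codimension, hence
  dipole combinations of arbitrarily large energy norm, and so does not fit into the energy unit
  ball. That this ball is open for the energy seminorm needs the triangle inequality for
  arbitrary measures of mass 0; it follows from quasihypermetricity by approximating the energy by
  double Riemann sums over fine finite Borel partitions.
\<close>

section \<open>The Jordan decomposition of a finite signed measure\<close>

text \<open>\<open>ennreal\<close> truncates at 0, and truncation is subadditive. Terms of either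
  sign may occur.\<close>

lemma ennreal_sum_le: "ennreal (\<Sum>i\<in>I. f i) \<le> (\<Sum>i\<in>I. ennreal (f i))"
proof (induction I rule: infinite_finite_induct)
  case (insert i I)
  have "ennreal (f i + sum f I) \<le> ennreal (f i) + ennreal (sum f I)"
    by (cases "0 \<le> f i"; cases "0 \<le> sum f I")
      (auto simp: ennreal_plus ennreal_neg intro: ennreal_leI)
  with insert show ?case by (simp add: add_left_mono order_trans)
qed auto

lemma upper_variation_mono:
  fixes \<mu> :: "'a set \<Rightarrow> real"
  shows
  "A \<subseteq> C \<Longrightarrow> (SUP B\<in>{B \<in> sets N. B \<subseteq> A}. ennreal (\<mu> B)) \<le> (SUP B\<in>{B \<in> sets N. B \<subseteq> C}. ennreal (\<mu> B))"
  by (rule SUP_subset_mono) auto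

context
  fixes N :: "'a measure" and \<mu> :: "'a set \<Rightarrow> real"
  assumes signed: "\<mu> \<in> signed_measures N"
begin

lemma signed_empty: "\<mu> {} = 0"
  using signed by (simp add: signed_measures_def)

lemma signed_sums:
  "range A \<subseteq> sets N \<Longrightarrow> disjoint_family A \<Longrightarrow> (\<lambda>i::nat. \<mu> (A i)) sums \<mu> (\<Union>i. A i)"
  using signed by (simp add: signed_measures_def)

lemma signed_not_measurable: "A \<notin> sets N \<Longrightarrow> \<mu> A = 0"
  using signed by (simp add: signed_measures_def)

lemma signed_Un:
  assumes "A \<in> sets N" "B \<in> sets N" "A \<inter> B = {}"
  shows "\<mu> (A \<union> B) = \<mu> A + \<mu> B"
proof -
  have "disjoint_family (binaryset A B)"
    using assms(3) by (auto simp: disjoint_family_on_def binaryset_def)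
  moreover have "range (binaryset A B) \<subseteq> sets N"
    using assms by (auto simp: range_binaryset_eq)
  ultimately have "(\<lambda>i. \<mu> (binaryset A B i)) sums \<mu> (A \<union> B)"
    using signed_sums[of "binaryset A B"] by (simp add: UN_binaryset_eq)
  with binaryset_sums[of \<mu>, OF signed_empty, of A B] show ?thesis
    using sums_unique2 by blast
qed

lemma signed_Diff:
  assumes "A \<in> sets N" "B \<in> sets N" "B \<subseteq> A"
  shows "\<mu> (A - B) = \<mu> A - \<mu> B"
  using signed_Un[of "A - B" B] assms by (simp add: Un_absorb2 sets.Diff Int_commute)

text \<open>Competitors \<open>B\<close> inside \<open>A\<close> and \<open>D\<close> inside
  \<open>C\<close> are disjoint, so their union competes for \<open>A \<union> C\<close> with the
  sum of their values.\<close>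

lemma upper_variation_superadditive:
  assumes "A \<in> sets N" "C \<in> sets N" "A \<inter> C = {}"
  shows "(SUP B\<in>{B \<in> sets N. B \<subseteq> A}. ennreal (\<mu> B)) + (SUP B\<in>{B \<in> sets N. B \<subseteq> C}. ennreal (\<mu> B))
    \<le> (SUP B\<in>{B \<in> sets N. B \<subseteq> A \<union> C}. ennreal (\<mu> B))" (is "?S A + ?S C \<le> ?S (A \<union> C)")
proof -
  have *: "ennreal (\<mu> B) + ennreal (\<mu> D) \<le> ?S (A \<union> C)"
    if "B \<in> sets N" "B \<subseteq> A" "D \<in> sets N" "D \<subseteq> C" for B D
  proof -
    \<comment> \<open>A set of negative value is replaced by \<open>{}\<close>. This matches the
      truncation in \<open>ennreal\<close>, so that the two truncated values add up exactly.\<close>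
    define B' where "B' = (if \<mu> B \<ge> 0 then B else {})"
    define D' where "D' = (if \<mu> D \<ge> 0 then D else {})"
    have "B' \<union> D' \<in> sets N" "B' \<union> D' \<subseteq> A \<union> C" "B' \<in> sets N" "D' \<in> sets N" "B' \<inter> D' = {}"
      "0 \<le> \<mu> B'" "0 \<le> \<mu> D'"
      using that assms(3) by (auto simp: B'_def D'_def signed_empty)
    moreover have "ennreal (\<mu> B) = ennreal (\<mu> B')" "ennreal (\<mu> D) = ennreal (\<mu> D')"
      by (auto simp: B'_def D'_def signed_empty ennreal_neg)
    ultimately have "ennreal (\<mu> B) + ennreal (\<mu> D) = ennreal (\<mu> (B' \<union> D'))"
      using signed_Un[of B' D'] by (simp add: ennreal_plus)
    also have "\<dots> \<le> ?S (A \<union> C)"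
      using \<open>B' \<union> D' \<in> sets N\<close> \<open>B' \<union> D' \<subseteq> A \<union> C\<close> by (intro SUP_upper) auto
    finally show ?thesis .
  qed
  have ne: "{B \<in> sets N. B \<subseteq> A} \<noteq> {}" "{B \<in> sets N. B \<subseteq> C} \<noteq> {}" by auto
  show ?thesis
    unfolding ennreal_SUP_add_left[OF ne(1), symmetric] ennreal_SUP_add_right[OF ne(2)]
    by (intro SUP_least *) (auto simp: ennreal_SUP_add_right[OF ne(2), symmetric])
qed

text \<open>\<open>measure_of\<close> keeps the given set function only if that is a measure, so
  countable additivity has to be shown. Superadditivity and monotonicity bound the partial sums by
  the value on the union; conversely, a competitor \<open>B\<close> for the union is cut into the
  pieces \<open>A i \<inter> B\<close>, to which countable additivity of \<open>\<mu>\<close>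
  applies.\<close>

lemma emeasure_upper_variation:
  assumes "A \<in> sets N"
  shows "emeasure (upper_variation N \<mu>) A = (SUP B\<in>{B \<in> sets N. B \<subseteq> A}. ennreal (\<mu> B))"
proof -
  define S where "S A = (SUP B\<in>{B \<in> sets N. B \<subseteq> A}. ennreal (\<mu> B))" for A
  have pos: "positive (sets N) S"
    by (simp add: positive_def S_def signed_empty)
  have cadd: "countably_additive (sets N) S"
  proof (rule countably_additiveI)
    fix A :: "nat \<Rightarrow> 'a set"
    assume A: "range A \<subseteq> sets N" "disjoint_family A" "(\<Union>i. A i) \<in> sets N"
    show "(\<Sum>i. S (A i)) = S (\<Union>i. A i)"
    proof (rule antisym)
      have fin: "(\<Sum>i<n. S (A i)) \<le> S (\<Union>i<n. A i)" for n
      proof (induction n)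
        case 0
        show ?case by simp
      next
        case (Suc n)
        have "A i \<inter> A n = {}" if "i < n" for i
          using disjoint_family_onD[OF A(2), of i n] that by simp
        then have "(\<Union>i<n. A i) \<inter> A n = {}" by blast
        moreover have "(\<Union>i<n. A i) \<in> sets N" "A n \<in> sets N"
          using A(1) by (simp_all add: range_subsetD sets.finite_UN)
        ultimately have "S (\<Union>i<n. A i) + S (A n) \<le> S ((\<Union>i<n. A i) \<union> A n)"
          unfolding S_def by (intro upper_variation_superadditive)
        moreover have "(\<Union>i<n. A i) \<union> A n = (\<Union>i<Suc n. A i)" by (simp add: lessThan_Suc Un_commute)
        moreover have "(\<Sum>i<Suc n. S (A i)) \<le> S (\<Union>i<n. A i) + S (A n)"
          using Suc by (simp add: add_right_mono)
        ultimately show ?case by (metis order_trans)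
      qed
      have "S (\<Union>i<n. A i) \<le> S (\<Union>i. A i)" for n
        unfolding S_def by (intro upper_variation_mono) blast
      then have "(\<Sum>i<n. S (A i)) \<le> S (\<Union>i. A i)" for n
        using fin order_trans by blast
      then show "(\<Sum>i. S (A i)) \<le> S (\<Union>i. A i)"
        by (intro suminf_le_const) auto
    next
      show "S (\<Union>i. A i) \<le> (\<Sum>i. S (A i))"
        unfolding S_def[of "\<Union>i. A i"]
      proof (intro SUP_least)
        fix B assume B: "B \<in> {B \<in> sets N. B \<subseteq> (\<Union>i. A i)}"
        have "(\<lambda>i. \<mu> (A i \<inter> B)) sums \<mu> (\<Union>i. A i \<inter> B)"
          using A B by (intro signed_sums) (auto simp: disjoint_family_on_def)
        moreover have "(\<Union>i. A i \<inter> B) = B" using B by auto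
        ultimately have "(\<lambda>n. ennreal (\<Sum>i<n. \<mu> (A i \<inter> B))) \<longlonglongrightarrow> ennreal (\<mu> B)"
          by (simp add: sums_def tendsto_ennrealI)
        moreover have "ennreal (\<Sum>i<n. \<mu> (A i \<inter> B)) \<le> (\<Sum>i. S (A i))" for n
        proof -
          have "ennreal (\<Sum>i<n. \<mu> (A i \<inter> B)) \<le> (\<Sum>i<n. ennreal (\<mu> (A i \<inter> B)))"
            by (rule ennreal_sum_le)
          also have "\<dots> \<le> (\<Sum>i<n. S (A i))"
            unfolding S_def using A B by (intro sum_mono SUP_upper) auto
          also have "\<dots> \<le> (\<Sum>i. S (A i))" by (intro sum_le_suminf) auto
          finally show ?thesis .
        qed
        ultimately show "ennreal (\<mu> B) \<le> (\<Sum>i. S (A i))"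
          by (intro LIMSEQ_le_const2[where X="\<lambda>n. ennreal (\<Sum>i<n. \<mu> (A i \<inter> B))"]) auto
      qed
    qed
  qed
  have "emeasure (upper_variation N \<mu>) A = S A"
    unfolding upper_variation_def S_def[symmetric]
    using emeasure_measure_of_sigma[OF sets.sigma_algebra_axioms pos cadd assms] .
  then show ?thesis by (simp add: S_def)
qed

end

lemma sets_upper_variation [measurable_cong, simp]: "sets (upper_variation N \<mu>) = sets N"
  and space_upper_variation [simp]: "space (upper_variation N \<mu>) = space N"
  by (simp_all add: upper_variation_def sets.space_closed)

text \<open>If the upper variation of \<open>E\<close> is infinite, \<open>E\<close> splits into two pieces on which \<open>|\<mu>| \<ge> 1\<close>, one of
  which again has infinite upper variation. Iterating would produce disjoint sets on which \<open>\<mu>\<close> does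
  not tend to zero.\<close>
lemma emeasure_upper_variation_finite:
  assumes signed: "\<mu> \<in> signed_measures N"
  shows "emeasure (upper_variation N \<mu>) (space N) \<noteq> \<infinity>"
proof
  let ?u = "emeasure (upper_variation N \<mu>)"
  assume inf: "?u (space N) = \<infinity>"
  define P where "P E \<longleftrightarrow> E \<in> sets N \<and> ?u E = \<infinity>" for E
  have step: "\<exists>F. P F \<and> F \<subseteq> E \<and> \<bar>\<mu> (E - F)\<bar> \<ge> 1" if "P E" for E
  proof -
    have E: "E \<in> sets N" "?u E = \<infinity>" using that by (auto simp: P_def)
    \<comment> \<open>The threshold \<open>\<bar>\<mu> E\<bar> + 1\<close> forces both pieces to
      have values of modulus at least 1, because
      \<open>\<mu> (E - B) = \<mu> E - \<mu> B\<close>.\<close>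
    have "\<exists>B\<in>{B \<in> sets N. B \<subseteq> E}. ennreal (\<bar>\<mu> E\<bar> + 1) < ennreal (\<mu> B)"
      using E(2) unfolding emeasure_upper_variation[OF signed E(1)] less_SUP_iff[symmetric]
      by (simp only: infinity_ennreal_def ennreal_less_top)
    then obtain B where B: "B \<in> sets N" "B \<subseteq> E" "\<bar>\<mu> E\<bar> + 1 < \<mu> B"
      by (auto simp: ennreal_less_iff simp del: ennreal_plus)
    have "\<mu> (E - B) = \<mu> E - \<mu> B" using signed_Diff[OF signed] E B by auto
    with B have ge: "\<bar>\<mu> (E - B)\<bar> \<ge> 1" "\<bar>\<mu> B\<bar> \<ge> 1" by auto
    have EB: "E - (E - B) = B" using B by auto
    have "?u E \<le> ?u B + ?u (E - B)"
      using B E emeasure_subadditive[of B "upper_variation N \<mu>" "E - B"] by (simp add: Un_absorb1)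
    then have "?u B = \<infinity> \<or> ?u (E - B) = \<infinity>" using E(2) by (auto simp: top_unique)
    then show ?thesis
    proof
      assume "?u B = \<infinity>"
      then show ?thesis using B ge by (intro exI[of _ B]) (auto simp: P_def)
    next
      assume "?u (E - B) = \<infinity>"
      then show ?thesis using B E ge EB by (intro exI[of _ "E - B"]) (auto simp: P_def)
    qed
  qed
  have "\<exists>E :: nat \<Rightarrow> 'a set. \<forall>n. P (E n) \<and> E (Suc n) \<subseteq> E n \<and> \<bar>\<mu> (E n - E (Suc n))\<bar> \<ge> 1"
    using dependent_nat_choice[of "\<lambda>_. P" "\<lambda>_ E F. F \<subseteq> E \<and> \<bar>\<mu> (E - F)\<bar> \<ge> 1"] step inf
    by (auto simp: P_def)
  then obtain E :: "nat \<Rightarrow> 'a set" where E: "\<And>n. P (E n)" "\<And>n. E (Suc n) \<subseteq> E n"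
    "\<And>n. \<bar>\<mu> (E n - E (Suc n))\<bar> \<ge> 1" by blast
  have "decseq E" using E(2) by (simp add: decseq_Suc_iff)
  have dis: "(E m - E (Suc m)) \<inter> (E n - E (Suc n)) = {}" if "m < n" for m n
    using decseqD[OF \<open>decseq E\<close>, of "Suc m" n] that by auto
  have "disjoint_family (\<lambda>n. E n - E (Suc n))"
    unfolding disjoint_family_on_def using dis by (metis Int_commute nat_neq_iff)
  then have "(\<lambda>n. \<mu> (E n - E (Suc n))) sums \<mu> (\<Union>n. E n - E (Suc n))"
    using E(1) by (intro signed_sums[OF signed]) (auto simp: P_def)
  then have "(\<lambda>n. \<mu> (E n - E (Suc n))) \<longlonglongrightarrow> 0"
    by (rule summable_LIMSEQ_zero[OF sums_summable])
  then obtain n where "\<bar>\<mu> (E n - E (Suc n))\<bar> < 1"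
    using LIMSEQ_D[of _ 0 1] by fastforce
  with E(3)[of n] show False by simp
qed

lemma finite_measure_upper_variation:
  "\<mu> \<in> signed_measures N \<Longrightarrow> finite_measure (upper_variation N \<mu>)"
  using emeasure_upper_variation_finite by (intro finite_measureI) simp

lemma signed_uminus: "\<mu> \<in> signed_measures N \<Longrightarrow> (\<lambda>A. - \<mu> A) \<in> signed_measures N"
  by (auto simp: signed_measures_def sums_minus)

text \<open>For measurable \<open>B \<subseteq> A\<close> one has
  \<open>\<mu> B = \<mu> A - \<mu> (A - B)\<close>, and \<open>- \<mu> (A - B)\<close> is at most
  the lower variation of \<open>A\<close>. The supremum over \<open>B\<close> gives one inequality,
  and \<open>- \<mu>\<close> in place of \<open>\<mu>\<close> gives the other.\<close>

lemma Jordan_decomposition: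
  assumes \<mu>: "\<mu> \<in> signed_measures N"
  shows "measure (upper_variation N \<mu>) A - measure (upper_variation N (\<lambda>A. - \<mu> A)) A = \<mu> A"
proof (cases "A \<in> sets N")
  case False
  then show ?thesis by (simp add: measure_notin_sets signed_not_measurable[OF \<mu>])
next
  case A: True
  have half: "measure (upper_variation N \<mu>) A \<le> \<mu> A + measure (upper_variation N (\<lambda>A. - \<mu> A)) A"
    if \<mu>: "\<mu> \<in> signed_measures N" for \<mu>
  proof -
    interpret p: finite_measure "upper_variation N \<mu>" using \<mu> by (rule finite_measure_upper_variation)
    interpret n: finite_measure "upper_variation N (\<lambda>A. - \<mu> A)"
      using signed_uminus[OF \<mu>] by (rule finite_measure_upper_variation)
    have bound: "\<mu> B \<le> \<mu> A + measure (upper_variation N (\<lambda>A. - \<mu> A)) A" if "B \<in> sets N" "B \<subseteq> A" for B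
    proof -
      have "ennreal (- \<mu> (A - B)) \<le> ennreal (measure (upper_variation N (\<lambda>A. - \<mu> A)) A)"
        unfolding n.emeasure_eq_measure[symmetric] emeasure_upper_variation[OF signed_uminus[OF \<mu>] A]
        using A that by (intro SUP_upper) auto
      then have "- \<mu> (A - B) \<le> measure (upper_variation N (\<lambda>A. - \<mu> A)) A"
        by (simp add: ennreal_le_iff)
      with signed_Diff[OF \<mu> A that] show ?thesis by simp
    qed
    \<comment> \<open>An inequality can be read back from \<open>ennreal\<close> once its right-hand
      side is nonnegative; the competitor \<open>{}\<close> provides this.\<close>
    have nonneg: "0 \<le> \<mu> A + measure (upper_variation N (\<lambda>A. - \<mu> A)) A"
      using bound[of "{}"] signed_empty[OF \<mu>] by simp
    have "ennreal (measure (upper_variation N \<mu>) A) \<le> ennreal (\<mu> A + measure (upper_variation N (\<lambda>A. - \<mu> A)) A)"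
      unfolding p.emeasure_eq_measure[symmetric] emeasure_upper_variation[OF \<mu> A]
      using bound by (intro SUP_least ennreal_leI) auto
    with nonneg show ?thesis by (simp add: ennreal_le_iff)
  qed
  show ?thesis using half[OF \<mu>] half[OF signed_uminus[OF \<mu>]] by simp
qed


section \<open>Riemann sums against signed measures\<close>

lemma space_borel_of [simp]: "space (borel_of T) = topspace T"
  using openin_subset[of T] by (auto simp: borel_of_def space_measure_of_conv)

lemma openin_in_sets_borel_of: "openin T U \<Longrightarrow> U \<in> sets (borel_of T)"
  using openin_subset[of T] by (auto simp: borel_of_def sets_measure_of)

lemma continuous_map_borel_measurable:
  assumes "continuous_map T euclideanreal f"
  shows "f \<in> borel_measurable (borel_of T)"
proof (rule borel_measurableI)
  fix S :: "real set" assume "open S"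
  then have "openin T {x \<in> topspace T. f x \<in> S}"
    using openin_continuous_map_preimage[OF assms] by simp
  moreover have "f -` S \<inter> space (borel_of T) = {x \<in> topspace T. f x \<in> S}" by auto
  ultimately show "f -` S \<inter> space (borel_of T) \<in> sets (borel_of T)"
    by (simp add: openin_in_sets_borel_of)
qed

section \<open>Linear combinations of signed measures\<close>

lemma signed_measures_sum:
  assumes "\<And>i. i \<in> I \<Longrightarrow> \<mu> i \<in> signed_measures N"
  shows "(\<lambda>A. \<Sum>i\<in>I. c i * \<mu> i A) \<in> signed_measures N"
  using assms by (auto simp: signed_measures_def intro!: sums_sum sums_mult sum.neutral)

lemma signed_measures_add_mult:
  assumes "\<mu> \<in> signed_measures N" "\<nu> \<in> signed_measures N"
  shows "(\<lambda>A. \<mu> A + t * \<nu> A) \<in> signed_measures N"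
  using assms by (auto simp: signed_measures_def intro!: sums_add sums_mult)

context Metric_space
begin

section \<open>Lipschitz functions and the distance function\<close>

lemma Lipschitz_continuous_map:
  fixes f :: "'a \<Rightarrow> real"
  assumes L: "\<And>x y. x \<in> M \<Longrightarrow> y \<in> M \<Longrightarrow> \<bar>f x - f y\<bar> \<le> L * d x y"
  shows "continuous_map mtopology euclideanreal f"
proof -
  have "openin mtopology {x \<in> M. f x \<in> U}" if "open U" for U
    unfolding openin_mtopology
  proof (intro conjI allI impI)
    fix x assume x: "x \<in> {x \<in> M. f x \<in> U}"
    then obtain e where e: "e > 0" "\<And>y. \<bar>y - f x\<bar> < e \<Longrightarrow> y \<in> U"
      using \<open>open U\<close> unfolding open_dist dist_real_def by blast
    \<comment> \<open>Adding 1 keeps the radius well defined and positive when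
      \<open>L = 0\<close>.\<close>
    have "mball x (e / (\<bar>L\<bar> + 1)) \<subseteq> {x \<in> M. f x \<in> U}"
    proof
      fix y assume "y \<in> mball x (e / (\<bar>L\<bar> + 1))"
      then have y: "y \<in> M" "d y x < e / (\<bar>L\<bar> + 1)" by (auto simp: commute)
      have "\<bar>f y - f x\<bar> \<le> L * d y x" using L y x by simp
      also have "\<dots> \<le> (\<bar>L\<bar> + 1) * d y x" by (intro mult_right_mono) auto
      also have "\<dots> < e" using y by (simp add: field_simps)
      finally show "y \<in> {x \<in> M. f x \<in> U}" using y e by simp
    qed
    then show "\<exists>r>0. mball x r \<subseteq> {x \<in> M. f x \<in> U}"
      using e(1) by (intro exI[of _ "e / (\<bar>L\<bar> + 1)"]) auto
  qed auto
  then show ?thesis by (auto simp: continuous_map_def)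
qed

lemma dist_diff_le: "x \<in> M \<Longrightarrow> y \<in> M \<Longrightarrow> z \<in> M \<Longrightarrow> \<bar>d x z - d y z\<bar> \<le> d x y"
  using triangle[of x y z] triangle[of y x z] by (simp add: commute)

lemma continuous_map_dist: "z \<in> M \<Longrightarrow> continuous_map mtopology euclideanreal (\<lambda>x. d x z)"
  using dist_diff_le by (intro Lipschitz_continuous_map[where L=1]) auto

end

locale compact_metric = Metric_space +
  assumes compact_M: "compact_space mtopology"
begin

abbreviation "\<M> \<equiv> signed_measures borel_sets"
abbreviation "\<M>\<^sub>0 \<equiv> null_mass_measures borel_sets"
abbreviation "\<I> \<equiv> signed_integral borel_sets"

lemma M0_signed: "\<mu> \<in> \<M>\<^sub>0 \<Longrightarrow> \<mu> \<in> \<M>"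
  by (simp add: null_mass_measures_def)

lemma M0_mass: "\<mu> \<in> \<M>\<^sub>0 \<Longrightarrow> \<mu> M = 0"
  by (simp add: null_mass_measures_def)

section \<open>Total variation and bounds for integrals\<close>

definition total_variation :: "('a set \<Rightarrow> real) \<Rightarrow> real" where
  "total_variation \<mu> = measure (upper_variation borel_sets \<mu>) M
     + measure (upper_variation borel_sets (\<lambda>A. - \<mu> A)) M"

lemma total_variation_nonneg: "0 \<le> total_variation \<mu>"
  by (simp add: total_variation_def)

lemma integrable_upper_variation:
  fixes f :: "'a \<Rightarrow> real"
  assumes "\<mu> \<in> \<M>" "f \<in> borel_measurable borel_sets" "\<And>x. x \<in> M \<Longrightarrow> \<bar>f x\<bar> \<le> C"
  shows "integrable (upper_variation borel_sets \<mu>) f"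
proof -
  interpret finite_measure "upper_variation borel_sets \<mu>"
    using assms(1) by (rule finite_measure_upper_variation)
  show ?thesis
    using assms(2,3) by (intro integrable_const_bound[of f C]) auto
qed

lemma signed_integral_bound:
  assumes "\<mu> \<in> \<M>" "f \<in> borel_measurable borel_sets" "\<And>x. x \<in> M \<Longrightarrow> \<bar>f x\<bar> \<le> C"
  shows "\<bar>\<I> \<mu> f\<bar> \<le> C * total_variation \<mu>"
proof -
  have *: "\<bar>\<integral>x. f x \<partial>upper_variation borel_sets \<mu>\<bar> \<le> C * measure (upper_variation borel_sets \<mu>) M"
    if "\<mu> \<in> \<M>" for \<mu>
  proof -
    interpret finite_measure "upper_variation borel_sets \<mu>"
      using that by (rule finite_measure_upper_variation)
    have "\<bar>\<integral>x. f x \<partial>upper_variation borel_sets \<mu>\<bar> \<le> (\<integral>x. \<bar>f x\<bar> \<partial>upper_variation borel_sets \<mu>)"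
      by (rule integral_abs_bound)
    also have "\<dots> \<le> (\<integral>x. C \<partial>upper_variation borel_sets \<mu>)"
      using assms integrable_upper_variation[OF that assms(2,3)] by (intro integral_mono) auto
    finally show ?thesis by (simp add: mult.commute)
  qed
  from *[OF assms(1)] *[OF signed_uminus[OF assms(1)]] show ?thesis
    unfolding signed_integral_def total_variation_def by (simp add: distrib_left)
qed

lemma signed_integral_diff:
  assumes "\<mu> \<in> \<M>" "f \<in> borel_measurable borel_sets" "\<And>x. x \<in> M \<Longrightarrow> \<bar>f x\<bar> \<le> C"
    and "g \<in> borel_measurable borel_sets" "\<And>x. x \<in> M \<Longrightarrow> \<bar>g x\<bar> \<le> D"
  shows "\<I> \<mu> (\<lambda>x. f x - g x) = \<I> \<mu> f - \<I> \<mu> g"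
  using integrable_upper_variation[OF _ assms(2,3)] integrable_upper_variation[OF _ assms(4,5)]
    assms(1) signed_uminus[OF assms(1)]
  by (simp add: signed_integral_def)

text \<open>A finite tagged Borel partition, encoded by the map that sends each point to the tag of
  its cell: the cells are the fibres of \<open>s\<close>. A tag may lie outside its own cell, but it
  is within \<epsilon> of every point of the cell.\<close>

definition mesh :: "real \<Rightarrow> ('a \<Rightarrow> 'a) \<Rightarrow> bool" where
  "mesh \<epsilon> s \<longleftrightarrow> finite (s ` M) \<and> s ` M \<subseteq> M \<and> (\<forall>z. {x \<in> M. s x = z} \<in> sets borel_sets)
     \<and> (\<forall>x\<in>M. d x (s x) < \<epsilon>)"

definition riemann_sum :: "('a \<Rightarrow> 'a) \<Rightarrow> ('a set \<Rightarrow> real) \<Rightarrow> ('a \<Rightarrow> real) \<Rightarrow> real" where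
  "riemann_sum s \<mu> f = (\<Sum>z\<in>s ` M. f z * \<mu> {x \<in> M. s x = z})"

text \<open>Total boundedness gives a finite cover by balls. The balls are added one at a time, and
  each new ball takes its points away from the earlier cells, which keeps the cells disjoint and
  Borel.\<close>

lemma mesh_exists:
  assumes "\<epsilon> > 0"
  shows "\<exists>s. mesh \<epsilon> s"
proof (cases "M = {}")
  case True
  then show ?thesis unfolding mesh_def by simp
next
  case False
  then obtain x0 where x0: "x0 \<in> M" by blast
  have "mtotally_bounded M"
    using compact_M compact_space_eq_mcomplete_mtotally_bounded by blast
  then obtain K where K: "finite K" "K \<subseteq> M" "M \<subseteq> (\<Union>x\<in>K. mball x \<epsilon>)"
    using assms unfolding mtotally_bounded_def by meson
  \<comment> \<open>\<open>x0\<close> is the default tag of the points that no ball covers yet. The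
    distance estimate is claimed on the balls only; since all of them together cover
    \<open>M\<close>, it finally holds everywhere.\<close>
  have "\<exists>s. s ` M \<subseteq> insert x0 K \<and> (\<forall>z. {x \<in> M. s x = z} \<in> sets borel_sets)
     \<and> (\<forall>y\<in>K. \<forall>x\<in>mball y \<epsilon>. d x (s x) < \<epsilon>)"
    using K(1,2)
  proof (induction K)
    case empty
    have "{x \<in> M. x0 = z} \<in> sets borel_sets" for z
    proof -
      have "{x \<in> M. x0 = z} = (if x0 = z then M else {})" by simp
      moreover have "M \<in> sets borel_sets" using openin_in_sets_borel_of[OF openin_topspace, of mtopology] by simp
      ultimately show ?thesis by simp
    qed
    then show ?case by (intro exI[of _ "\<lambda>_. x0"]) (simp add: image_subset_iff)
  next
    case (insert y K)
    then obtain s where s: "s ` M \<subseteq> insert x0 K" "\<And>z. {x \<in> M. s x = z} \<in> sets borel_sets"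
       "\<And>x y. y \<in> K \<Longrightarrow> x \<in> mball y \<epsilon> \<Longrightarrow> d x (s x) < \<epsilon>" by (metis insert_subset)
    define s' where "s' x = (if x \<in> mball y \<epsilon> then y else s x)" for x
    have B: "mball y \<epsilon> \<in> sets borel_sets" by (intro openin_in_sets_borel_of openin_mball)
    have "{x \<in> M. s' x = z} = (if z = y then mball y \<epsilon> else {}) \<union> ({x \<in> M. s x = z} - mball y \<epsilon>)" for z
      by (auto simp: s'_def)
    then have "{x \<in> M. s' x = z} \<in> sets borel_sets" for z
      using B s(2)[of z] by auto
    moreover have "d x (s' x) < \<epsilon>" if "w \<in> insert y K" "x \<in> mball w \<epsilon>" for x w
      using that s(3)[of w x] by (auto simp: s'_def commute)
    moreover have "s' ` M \<subseteq> insert x0 (insert y K)" using s(1) by (auto simp: s'_def)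
    ultimately show ?case by blast
  qed
  then obtain s where s: "s ` M \<subseteq> insert x0 K" "\<And>z. {x \<in> M. s x = z} \<in> sets borel_sets"
       "\<And>x y. y \<in> K \<Longrightarrow> x \<in> mball y \<epsilon> \<Longrightarrow> d x (s x) < \<epsilon>" by metis
  have "finite (s ` M)" using s(1) K(1) finite_subset by blast
  moreover have "s ` M \<subseteq> M" using s(1) K(2) x0 by auto
  moreover have "d x (s x) < \<epsilon>" if "x \<in> M" for x using s(3) K(3) that by blast
  ultimately have "mesh \<epsilon> s" unfolding mesh_def using s(2) by simp
  then show ?thesis by blast
qed

text \<open>Exhibits \<open>f\<close> composed with \<open>s\<close> as a simple function, which
  yields both its measurability and its integral.\<close>

lemma mesh_representation:
  assumes "mesh \<epsilon> s" "x \<in> M"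
  shows "f (s x) = (\<Sum>z\<in>s ` M. f z * indicat_real {x \<in> M. s x = z} x)"
proof -
  have fin: "finite (s ` M)" using assms by (simp add: mesh_def)
  have "(\<Sum>z\<in>s ` M. f z * indicat_real {x \<in> M. s x = z} x) = (\<Sum>z\<in>s ` M. if z = s x then f z else 0)"
    using assms by (intro sum.cong) (auto simp: indicator_def)
  then show ?thesis using fin assms by (simp add: sum.delta)
qed

lemma mesh_measurable:
  assumes "mesh \<epsilon> s"
  shows "(\<lambda>x. f (s x) :: real) \<in> borel_measurable borel_sets"
proof -
  have "{x \<in> M. s x = z} \<in> sets borel_sets" for z using assms by (simp add: mesh_def)
  then have "(\<lambda>x. \<Sum>z\<in>s ` M. f z * indicat_real {x \<in> M. s x = z} x) \<in> borel_measurable borel_sets"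
    by measurable
  then show ?thesis
    by (subst measurable_cong[OF mesh_representation[OF assms]]) auto
qed

text \<open>Each Jordan part integrates the simple function to a finite sum over the cells, and the
  Jordan decomposition merges the two sums into one with the values of \<open>\<mu>\<close>
  itself.\<close>

lemma riemann_sum_eq_integral:
  assumes s: "mesh \<epsilon> s" and \<mu>: "\<mu> \<in> \<M>"
  shows "riemann_sum s \<mu> f = \<I> \<mu> (\<lambda>x. f (s x))"
proof -
  have *: "(\<integral>x. f (s x) \<partial>upper_variation borel_sets \<mu>)
    = (\<Sum>z\<in>s ` M. f z * measure (upper_variation borel_sets \<mu>) {x \<in> M. s x = z})" if "\<mu> \<in> \<M>" for \<mu>
  proof -
    interpret finite_measure "upper_variation borel_sets \<mu>"
      using that by (rule finite_measure_upper_variation)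
    have [measurable]: "{x \<in> M. s x = z} \<in> sets borel_sets" for z using s by (simp add: mesh_def)
    have "(\<integral>x. f (s x) \<partial>upper_variation borel_sets \<mu>)
      = (\<integral>x. (\<Sum>z\<in>s ` M. f z * indicat_real {x \<in> M. s x = z} x) \<partial>upper_variation borel_sets \<mu>)"
      by (intro Bochner_Integration.integral_cong mesh_representation[OF s]) auto
    also have "\<dots> = (\<Sum>z\<in>s ` M. \<integral>x. f z * indicat_real {x \<in> M. s x = z} x \<partial>upper_variation borel_sets \<mu>)"
      by (intro Bochner_Integration.integral_sum integrable_mult_right integrable_real_indicator)
        (simp_all add: emeasure_eq_measure)
    also have "\<dots> = (\<Sum>z\<in>s ` M. f z * measure (upper_variation borel_sets \<mu>) {x \<in> M. s x = z})"
      by (intro sum.cong refl) (simp add: Int_absorb2 subset_eq)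
    finally show ?thesis .
  qed
  show ?thesis
    unfolding signed_integral_def *[OF \<mu>] *[OF signed_uminus[OF \<mu>]] riemann_sum_def
      sum_subtractf[symmetric] right_diff_distrib[symmetric] Jordan_decomposition[OF \<mu>] ..
qed

lemma continuous_map_bounded:
  assumes "continuous_map mtopology euclideanreal f"
  obtains C where "\<And>x. x \<in> M \<Longrightarrow> \<bar>f x\<bar> \<le> C"
proof -
  have "compactin euclideanreal (f ` M)"
    using image_compactin[OF _ assms] compact_M by (simp add: compact_space_def)
  then have "bounded (f ` M)" by (simp add: compact_imp_bounded)
  then show ?thesis using that unfolding bounded_iff by (metis imageI real_norm_def)
qed

lemma mesh_tendsto:
  assumes s: "\<And>n. mesh (\<epsilon> n) (s n)" and \<epsilon>: "\<epsilon> \<longlonglongrightarrow> 0"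
    and f: "continuous_map mtopology euclideanreal f" and x: "x \<in> M"
  shows "(\<lambda>n. f (s n x)) \<longlonglongrightarrow> f x"
proof -
  have "(\<lambda>n. d (s n x) x) \<longlonglongrightarrow> 0"
    by (rule tendsto_sandwich[OF _ _ tendsto_const \<epsilon>])
      (use s x in \<open>auto simp: mesh_def commute less_imp_le\<close>)
  then have "limitin mtopology (\<lambda>n. s n x) x sequentially"
    using s x by (auto simp: limitin_metric_dist_null mesh_def image_subset_iff)
  from continuous_map_limit[OF f this] show ?thesis by (simp add: o_def)
qed

text \<open>Dominated convergence on each Jordan part, with a bound of \<open>f\<close> as the
  constant majorant.\<close>

lemma riemann_sum_tendsto:
  assumes s: "\<And>n. mesh (\<epsilon> n) (s n)" and \<epsilon>: "\<epsilon> \<longlonglongrightarrow> 0"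
    and f: "continuous_map mtopology euclideanreal f" and \<mu>: "\<mu> \<in> \<M>"
  shows "(\<lambda>n. riemann_sum (s n) \<mu> f) \<longlonglongrightarrow> \<I> \<mu> f"
proof -
  obtain C where C: "\<And>x. x \<in> M \<Longrightarrow> \<bar>f x\<bar> \<le> C" using continuous_map_bounded[OF f] by blast
  have "(\<lambda>n. \<integral>x. f (s n x) \<partial>upper_variation borel_sets \<mu>) \<longlonglongrightarrow> (\<integral>x. f x \<partial>upper_variation borel_sets \<mu>)"
    if "\<mu> \<in> \<M>" for \<mu>
  proof (rule integral_dominated_convergence[where w="\<lambda>_. C"])
    interpret finite_measure "upper_variation borel_sets \<mu>"
      using that by (rule finite_measure_upper_variation)
    show "integrable (upper_variation borel_sets \<mu>) (\<lambda>_. C)" by simp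
    show "f \<in> borel_measurable (upper_variation borel_sets \<mu>)"
      using continuous_map_borel_measurable[OF f] by simp
    show "(\<lambda>x. f (s n x)) \<in> borel_measurable (upper_variation borel_sets \<mu>)" for n
      using mesh_measurable[OF s] by simp
    show "AE x in upper_variation borel_sets \<mu>. (\<lambda>n. f (s n x)) \<longlonglongrightarrow> f x"
      using mesh_tendsto[OF s \<epsilon> f] by (intro AE_I2) simp
    show "AE x in upper_variation borel_sets \<mu>. norm (f (s n x)) \<le> C" for n
      using C s[of n] by (intro AE_I2) (simp add: mesh_def image_subset_iff)
  qed
  from tendsto_diff[OF this[OF \<mu>] this[OF signed_uminus[OF \<mu>]]] show ?thesis
    by (simp add: riemann_sum_eq_integral[OF s \<mu>] signed_integral_def)
qed

lemma mesh_sequence: "\<exists>s. \<forall>n. mesh (inverse (real (Suc n))) (s n)"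
  using mesh_exists by (intro choice allI) simp

text \<open>The Jordan parts of a sum are in general not the sums of the Jordan parts, so linearity
  in the measure is not visible in \<open>signed_integral\<close>. Riemann sums are plainly linear
  in the measure, and linearity survives the limit.\<close>

lemma signed_integral_sum:
  assumes f: "continuous_map mtopology euclideanreal f" and \<mu>: "\<And>i. i \<in> I \<Longrightarrow> \<mu> i \<in> \<M>"
  shows "\<I> (\<lambda>A. \<Sum>i\<in>I. c i * \<mu> i A) f = (\<Sum>i\<in>I. c i * \<I> (\<mu> i) f)"
proof -
  obtain s where s: "\<And>n. mesh (inverse (real (Suc n))) (s n)" using mesh_sequence by blast
  note lim = riemann_sum_tendsto[OF s LIMSEQ_inverse_real_of_nat f]
  have "(\<lambda>n. \<Sum>i\<in>I. c i * riemann_sum (s n) (\<mu> i) f) \<longlonglongrightarrow> (\<Sum>i\<in>I. c i * \<I> (\<mu> i) f)"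
    using \<mu> by (intro tendsto_sum tendsto_mult_left lim)
  moreover have "riemann_sum s (\<lambda>A. \<Sum>i\<in>I. c i * \<mu> i A) f = (\<Sum>i\<in>I. c i * riemann_sum s (\<mu> i) f)" for s
    unfolding riemann_sum_def sum_distrib_left
    by (subst sum.swap) (simp add: ac_simps)
  moreover have "(\<lambda>n. riemann_sum (s n) (\<lambda>A. \<Sum>i\<in>I. c i * \<mu> i A) f) \<longlonglongrightarrow> \<I> (\<lambda>A. \<Sum>i\<in>I. c i * \<mu> i A) f"
    using \<mu> by (intro lim signed_measures_sum)
  ultimately show ?thesis by (simp add: LIMSEQ_unique)
qed

text \<open>The value 0 off the Borel sets is the normalization demanded by
  \<open>signed_measures\<close>.\<close>

definition point_mass :: "'a \<Rightarrow> 'a set \<Rightarrow> real" where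
  "point_mass a A = (if A \<in> sets borel_sets \<and> a \<in> A then 1 else 0)"

lemma point_mass_signed: "point_mass a \<in> \<M>"
  unfolding signed_measures_def mem_Collect_eq
proof (intro conjI allI impI)
  fix A :: "nat \<Rightarrow> 'a set" assume A: "range A \<subseteq> sets borel_sets" "disjoint_family A"
  then have U: "(\<Union>i. A i) \<in> sets borel_sets" "\<And>i. A i \<in> sets borel_sets"
    by (simp_all add: sets.countable_UN range_subsetD)
  show "(\<lambda>i. point_mass a (A i)) sums point_mass a (\<Union>i. A i)"
  proof (cases "\<exists>j. a \<in> A j")
    case True
    then obtain j where j: "a \<in> A j" ..
    have "a \<in> A i \<longleftrightarrow> i = j" for i
      using disjoint_family_onD[OF A(2), of i j] j by auto
    then have "(\<lambda>i. point_mass a (A i)) = (\<lambda>i. if i = j then 1 else 0)"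
      using U by (auto simp: point_mass_def)
    with j U sums_single[of j "\<lambda>_. 1"] show ?thesis by (auto simp: point_mass_def)
  qed (auto simp: point_mass_def)
qed (auto simp: point_mass_def)

text \<open>The Riemann sum is exactly \<open>f (s n a)\<close>, since \<open>a\<close> lies in a
  single cell; no Jordan decomposition has to be computed.\<close>

lemma signed_integral_point_mass:
  assumes "a \<in> M" and f: "continuous_map mtopology euclideanreal f"
  shows "\<I> (point_mass a) f = f a"
proof -
  obtain s where s: "\<And>n. mesh (inverse (real (Suc n))) (s n)" using mesh_sequence by blast
  have "riemann_sum (s n) (point_mass a) f = f (s n a)" for n
    unfolding mesh_representation[OF s assms(1), of f n] riemann_sum_def
    using s[of n] assms(1) by (intro sum.cong) (auto simp: mesh_def point_mass_def indicator_def)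
  then show ?thesis
    using riemann_sum_tendsto[OF s LIMSEQ_inverse_real_of_nat f point_mass_signed[of a]]
      mesh_tendsto[OF s LIMSEQ_inverse_real_of_nat f assms(1)] by (simp add: LIMSEQ_unique)
qed

end


section \<open>Energy\<close>

text \<open>The source of the Cauchy-Schwarz inequality for a form that is only semidefinite, so
  that \<open>q = 0\<close> has to be allowed.\<close>

lemma quadratic_nonneg_discriminant:
  fixes p b q :: real
  assumes nonneg: "\<And>t. 0 \<le> p + 2 * t * b + t\<^sup>2 * q"
  shows "b\<^sup>2 \<le> p * q"
proof (cases "q = 0")
  case True
  \<comment> \<open>For nonzero \<open>b\<close> this \<open>t\<close> would give the polynomial the
    value -1.\<close>
  then have "b = 0"
    using nonneg[of "- (p + 1) / (2 * b)"] by (cases "b = 0") (auto simp: field_simps)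
  with True show ?thesis by simp
next
  case False
  have "0 \<le> q"
  proof (rule ccontr)
    assume "\<not> 0 \<le> q"
    \<comment> \<open>Chosen so that \<open>t\<^sup>2 * q = - (p + 1)\<close>. Adding the values at
      \<open>t\<close> and \<open>- t\<close> cancels the linear term and leaves -2.\<close>
    define t where "t = sqrt ((p + 1) / - q)"
    have "0 \<le> p" using nonneg[of 0] by simp
    with \<open>\<not> 0 \<le> q\<close> have "0 \<le> (p + 1) / - q" by (intro divide_nonneg_pos) auto
    then have "t\<^sup>2 = (p + 1) / - q" unfolding t_def by (rule real_sqrt_pow2)
    then have "t\<^sup>2 * q = - (p + 1)" using \<open>\<not> 0 \<le> q\<close> by (simp add: field_simps)
    then show False using nonneg[of t] nonneg[of "- t"] by simp
  qed
  with False have "0 < q" by simp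
  \<comment> \<open>The parabola is evaluated at its minimum.\<close>
  have "p + 2 * (- b / q) * b + (- b / q)\<^sup>2 * q = p - b\<^sup>2 / q"
    using False by (simp add: power2_eq_square field_simps)
  with nonneg[of "- b / q"] have "b\<^sup>2 / q \<le> p" by simp
  then show ?thesis using \<open>0 < q\<close> by (simp add: field_simps)
qed

context compact_metric
begin

text \<open>A rate that depends on \<open>f\<close> through its Lipschitz constant alone. Double
  sums need this uniformity: all functions \<open>\<lambda>x. d x y\<close> have Lipschitz constant
  1.\<close>

lemma riemann_sum_error:
  assumes s: "mesh \<epsilon> s" and \<mu>: "\<mu> \<in> \<M>" and "0 \<le> L"
    and L: "\<And>x y. x \<in> M \<Longrightarrow> y \<in> M \<Longrightarrow> \<bar>f x - f y\<bar> \<le> L * d x y"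
  shows "\<bar>\<I> \<mu> f - riemann_sum s \<mu> f\<bar> \<le> L * \<epsilon> * total_variation \<mu>"
proof -
  have cont: "continuous_map mtopology euclideanreal f"
    using L by (rule Lipschitz_continuous_map)
  obtain C where C: "\<And>x. x \<in> M \<Longrightarrow> \<bar>f x\<bar> \<le> C" using continuous_map_bounded[OF cont] by blast
  have sM: "s x \<in> M" if "x \<in> M" for x using s that by (auto simp: mesh_def)
  have Cs: "\<bar>f (s x)\<bar> \<le> C" if "x \<in> M" for x using C sM that by blast
  have "\<I> \<mu> f - riemann_sum s \<mu> f = \<I> \<mu> (\<lambda>x. f x - f (s x))"
    unfolding riemann_sum_eq_integral[OF s \<mu>]
    using signed_integral_diff[OF \<mu> continuous_map_borel_measurable[OF cont] C mesh_measurable[OF s, of f] Cs]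
    by simp
  also have "\<bar>\<dots>\<bar> \<le> L * \<epsilon> * total_variation \<mu>"
  proof (rule signed_integral_bound[OF \<mu>])
    show "(\<lambda>x. f x - f (s x)) \<in> borel_measurable borel_sets"
      using continuous_map_borel_measurable[OF cont] mesh_measurable[OF s] by (rule borel_measurable_diff)
    show "\<bar>f x - f (s x)\<bar> \<le> L * \<epsilon>" if "x \<in> M" for x
    proof -
      have "d x (s x) \<le> \<epsilon>" using s that by (auto simp: mesh_def less_imp_le)
      then show ?thesis
        using L[OF that sM[OF that]] mult_left_mono[OF _ \<open>0 \<le> L\<close>] order_trans by blast
    qed
  qed
  finally show ?thesis .
qed

section \<open>Potentials and double Riemann sums for the energy\<close>

definition potential :: "('a set \<Rightarrow> real) \<Rightarrow> 'a \<Rightarrow> real" where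
  "potential \<mu> y = \<I> \<mu> (\<lambda>x. d x y)"

lemma energy_eq_potential: "energy \<mu> \<nu> = \<I> \<nu> (potential \<mu>)"
  by (simp add: energy_def potential_def[abs_def])

text \<open>Integrates the pointwise bound of \<open>d z x - d z y\<close> by \<open>d x y\<close>.
  Hence the outer integrand of the energy is continuous, with an explicit Lipschitz
  constant.\<close>

lemma potential_Lipschitz:
  assumes \<mu>: "\<mu> \<in> \<M>" and "x \<in> M" "y \<in> M"
  shows "\<bar>potential \<mu> x - potential \<mu> y\<bar> \<le> total_variation \<mu> * d x y"
proof -
  obtain C where C: "\<And>z. z \<in> M \<Longrightarrow> \<bar>d z x\<bar> \<le> C"
    using continuous_map_bounded[OF continuous_map_dist[OF \<open>x \<in> M\<close>]] by blast
  obtain D where D: "\<And>z. z \<in> M \<Longrightarrow> \<bar>d z y\<bar> \<le> D"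
    using continuous_map_bounded[OF continuous_map_dist[OF \<open>y \<in> M\<close>]] by blast
  note meas = continuous_map_borel_measurable[OF continuous_map_dist]
  have "potential \<mu> x - potential \<mu> y = \<I> \<mu> (\<lambda>z. d z x - d z y)"
    unfolding potential_def
    using signed_integral_diff[OF \<mu> meas[OF \<open>x \<in> M\<close>] C meas[OF \<open>y \<in> M\<close>] D] by simp
  also have "\<bar>\<dots>\<bar> \<le> d x y * total_variation \<mu>"
    using assms dist_diff_le[of x y] commute
    by (intro signed_integral_bound borel_measurable_diff meas) (auto simp: commute)
  finally show ?thesis by (simp add: mult.commute)
qed

lemma potential_continuous: "\<mu> \<in> \<M> \<Longrightarrow> continuous_map mtopology euclideanreal (potential \<mu>)"
  using potential_Lipschitz by (rule Lipschitz_continuous_map)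

text \<open>The mutual energy of the two discrete measures that concentrate the mass of each cell at
  its tag.\<close>

definition energy_sum :: "('a \<Rightarrow> 'a) \<Rightarrow> ('a set \<Rightarrow> real) \<Rightarrow> ('a set \<Rightarrow> real) \<Rightarrow> real" where
  "energy_sum s \<mu> \<nu> =
     (\<Sum>w\<in>s ` M. \<Sum>z\<in>s ` M. d z w * \<mu> {x \<in> M. s x = z} * \<nu> {x \<in> M. s x = w})"

text \<open>Two errors of the same size add up: the outer integral of the Lipschitz potential is
  replaced by a Riemann sum, and then so is each inner integral. The function \<open>g\<close> is
  the inner error, bounded uniformly at the tags.\<close>

lemma energy_sum_error:
  assumes s: "mesh \<epsilon> s" and \<mu>: "\<mu> \<in> \<M>" and \<nu>: "\<nu> \<in> \<M>"
  shows "\<bar>energy \<mu> \<nu> - energy_sum s \<mu> \<nu>\<bar> \<le> 2 * (total_variation \<mu> * total_variation \<nu>) * \<epsilon>"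
proof -
  define g where "g w = potential \<mu> w - riemann_sum s \<mu> (\<lambda>z. d z w)" for w
  have "energy_sum s \<mu> \<nu> = riemann_sum s \<nu> (potential \<mu>) - riemann_sum s \<nu> g"
    unfolding energy_sum_def riemann_sum_def g_def sum_subtractf[symmetric] left_diff_distrib[symmetric]
    by (simp add: sum_distrib_right)
  then have "energy \<mu> \<nu> - energy_sum s \<mu> \<nu>
      = (\<I> \<nu> (potential \<mu>) - riemann_sum s \<nu> (potential \<mu>)) + riemann_sum s \<nu> g"
    by (simp add: energy_eq_potential)
  moreover have "\<bar>\<I> \<nu> (potential \<mu>) - riemann_sum s \<nu> (potential \<mu>)\<bar>
      \<le> total_variation \<mu> * \<epsilon> * total_variation \<nu>"
    using s \<nu> total_variation_nonneg potential_Lipschitz[OF \<mu>] by (rule riemann_sum_error)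
  moreover have "\<bar>riemann_sum s \<nu> g\<bar> \<le> total_variation \<mu> * \<epsilon> * total_variation \<nu>"
    unfolding riemann_sum_eq_integral[OF s \<nu>]
  proof (rule signed_integral_bound[OF \<nu> mesh_measurable[OF s]])
    fix x assume "x \<in> M"
    then have "s x \<in> M" using s by (auto simp: mesh_def)
    then have "\<bar>g (s x)\<bar> \<le> 1 * \<epsilon> * total_variation \<mu>"
      unfolding g_def potential_def
      using dist_diff_le by (intro riemann_sum_error[OF s \<mu>]) auto
    then show "\<bar>g (s x)\<bar> \<le> total_variation \<mu> * \<epsilon>" by (simp add: mult.commute)
  qed
  ultimately show ?thesis by (simp add: algebra_simps)
qed

lemma energy_sum_tendsto:
  assumes s: "\<And>n. mesh (\<epsilon> n) (s n)" and \<epsilon>: "\<epsilon> \<longlonglongrightarrow> 0" and "\<mu> \<in> \<M>" "\<nu> \<in> \<M>"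
  shows "(\<lambda>n. energy_sum (s n) \<mu> \<nu>) \<longlonglongrightarrow> energy \<mu> \<nu>"
proof -
  have "(\<lambda>n. 2 * (total_variation \<mu> * total_variation \<nu>) * \<epsilon> n) \<longlonglongrightarrow> 0"
    using tendsto_mult_left[OF \<epsilon>] by simp
  then have "(\<lambda>n. energy_sum (s n) \<mu> \<nu> - energy \<mu> \<nu>) \<longlonglongrightarrow> 0"
    by (rule Lim_null_comparison[rotated])
      (use energy_sum_error[OF s assms(3,4)] in \<open>simp add: abs_minus_commute\<close>)
  then show ?thesis by (rule LIM_zero_cancel)
qed

text \<open>Bilinearity and symmetry of the energy pass to the limit from finite double sums, where
  symmetry is a swap of summations; this takes the place of Fubini's theorem.\<close>

lemma energy_add_mult:
  assumes "\<mu> \<in> \<M>" "\<nu> \<in> \<M>"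
  shows "energy (\<lambda>A. \<mu> A + t * \<nu> A) (\<lambda>A. \<mu> A + t * \<nu> A)
    = energy \<mu> \<mu> + 2 * t * energy \<mu> \<nu> + t\<^sup>2 * energy \<nu> \<nu>"
proof -
  obtain s where s: "\<And>n. mesh (inverse (real (Suc n))) (s n)" using mesh_sequence by blast
  note lim = energy_sum_tendsto[OF s LIMSEQ_inverse_real_of_nat]
  have swap: "energy_sum s \<nu> \<mu> = energy_sum s \<mu> \<nu>" for s
    unfolding energy_sum_def by (subst sum.swap) (simp add: commute ac_simps)
  have "energy_sum s (\<lambda>A. \<mu> A + t * \<nu> A) (\<lambda>A. \<mu> A + t * \<nu> A)
     = energy_sum s \<mu> \<mu> + t * energy_sum s \<mu> \<nu> + t * energy_sum s \<nu> \<mu> + t\<^sup>2 * energy_sum s \<nu> \<nu>" for s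
    unfolding energy_sum_def sum_distrib_left sum.distrib[symmetric]
    by (intro sum.cong refl) (simp add: algebra_simps power2_eq_square)
  then have "energy_sum s (\<lambda>A. \<mu> A + t * \<nu> A) (\<lambda>A. \<mu> A + t * \<nu> A)
     = energy_sum s \<mu> \<mu> + 2 * t * energy_sum s \<mu> \<nu> + t\<^sup>2 * energy_sum s \<nu> \<nu>" for s
    by (simp add: swap)
  moreover have "(\<lambda>n. energy_sum (s n) \<mu> \<mu> + 2 * t * energy_sum (s n) \<mu> \<nu> + t\<^sup>2 * energy_sum (s n) \<nu> \<nu>)
     \<longlonglongrightarrow> energy \<mu> \<mu> + 2 * t * energy \<mu> \<nu> + t\<^sup>2 * energy \<nu> \<nu>"
    using assms by (intro tendsto_add tendsto_mult_left lim)
  moreover have "(\<lambda>n. energy_sum (s n) (\<lambda>A. \<mu> A + t * \<nu> A) (\<lambda>A. \<mu> A + t * \<nu> A))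
     \<longlonglongrightarrow> energy (\<lambda>A. \<mu> A + t * \<nu> A) (\<lambda>A. \<mu> A + t * \<nu> A)"
    using assms by (intro lim signed_measures_add_mult)
  ultimately show ?thesis by (simp add: LIMSEQ_unique)
qed

text \<open>The cell masses sum to the total mass 0, so they serve as coefficients, and the tags as
  points, in the quasihypermetric inequality.\<close>

lemma energy_sum_nonpos:
  assumes "quasihypermetric" and s: "mesh \<epsilon> s" and \<mu>: "\<mu> \<in> \<M>\<^sub>0"
  shows "energy_sum s \<mu> \<mu> \<le> 0"
proof -
  define \<alpha> where "\<alpha> z = \<mu> {x \<in> M. s x = z}" for z
  have "riemann_sum s \<mu> (\<lambda>_. 1) = \<I> \<mu> (\<lambda>_. 1)"
    by (rule riemann_sum_eq_integral[OF s M0_signed[OF \<mu>]])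
  also have "\<dots> = \<mu> M"
    by (simp add: signed_integral_def Jordan_decomposition[OF M0_signed[OF \<mu>]])
  finally have sum0: "(\<Sum>z\<in>s ` M. \<alpha> z) = 0"
    by (simp add: riemann_sum_def \<alpha>_def M0_mass[OF \<mu>])
  have "finite (s ` M)" using s by (simp add: mesh_def)
  \<comment> \<open>The tags are enumerated from 1 to match the index range in
    \<open>quasihypermetric\<close>.\<close>
  then obtain p where p: "bij_betw p {1..card (s ` M)} (s ` M)"
    using ex_bij_betw_nat_finite_1 by blast
  let ?n = "card (s ` M)"
  have "(\<Sum>i=1..?n. \<alpha> (p i)) = 0"
    using sum.reindex_bij_betw[OF p, of \<alpha>] sum0 by simp
  moreover have "\<forall>i\<in>{1..?n}. p i \<in> M"
    using p s by (auto simp: mesh_def bij_betw_def)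
  ultimately have "(\<Sum>i=1..?n. \<Sum>j=1..?n. \<alpha> (p i) * \<alpha> (p j) * d (p i) (p j)) \<le> 0"
    using assms(1) unfolding quasihypermetric_def
    by (elim allE[of _ ?n] allE[of _ "\<lambda>i. \<alpha> (p i)"] allE[of _ p]) blast
  also have "(\<Sum>i=1..?n. \<Sum>j=1..?n. \<alpha> (p i) * \<alpha> (p j) * d (p i) (p j))
      = (\<Sum>w\<in>s ` M. \<Sum>z\<in>s ` M. \<alpha> w * \<alpha> z * d w z)"
    unfolding sum.reindex_bij_betw[OF p, symmetric] ..
  finally show ?thesis
    unfolding energy_sum_def \<alpha>_def by (simp add: commute ac_simps)
qed

lemma energy_nonpos:
  assumes "quasihypermetric" "\<mu> \<in> \<M>\<^sub>0"
  shows "energy \<mu> \<mu> \<le> 0"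
proof -
  obtain s where s: "\<And>n. mesh (inverse (real (Suc n))) (s n)" using mesh_sequence by blast
  show ?thesis
  proof (rule LIMSEQ_le_const2)
    show "(\<lambda>n. energy_sum (s n) \<mu> \<mu>) \<longlonglongrightarrow> energy \<mu> \<mu>"
      using M0_signed[OF assms(2)] by (intro energy_sum_tendsto[OF s LIMSEQ_inverse_real_of_nat])
    show "\<exists>N. \<forall>n\<ge>N. energy_sum (s n) \<mu> \<mu> \<le> 0"
      using energy_sum_nonpos[OF assms(1) s assms(2)] by blast
  qed
qed

lemma M0_add_mult: "\<mu> \<in> \<M>\<^sub>0 \<Longrightarrow> \<nu> \<in> \<M>\<^sub>0 \<Longrightarrow> (\<lambda>A. \<mu> A + t * \<nu> A) \<in> \<M>\<^sub>0"
  by (simp add: null_mass_measures_def signed_measures_add_mult)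

text \<open>Nonpositive energy along the line \<open>\<mu> + t \<nu>\<close> makes a quadratic
  polynomial in \<open>t\<close> nonnegative. This gives Cauchy-Schwarz for the form
  \<open>- energy\<close>, and hence the triangle inequality.\<close>

lemma energy_norm_triangle:
  assumes q: "quasihypermetric" and \<mu>: "\<mu> \<in> \<M>\<^sub>0" and \<nu>: "\<nu> \<in> \<M>\<^sub>0"
  shows "energy_norm (\<lambda>A. \<mu> A + \<nu> A) \<le> energy_norm \<mu> + energy_norm \<nu>"
proof -
  note expand = energy_add_mult[OF M0_signed[OF \<mu>] M0_signed[OF \<nu>]]
  have "0 \<le> - energy \<mu> \<mu> + 2 * t * (- energy \<mu> \<nu>) + t\<^sup>2 * (- energy \<nu> \<nu>)" for t
    using energy_nonpos[OF q M0_add_mult[OF \<mu> \<nu>, of t]] expand[of t] by simp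
  then have "(- energy \<mu> \<nu>)\<^sup>2 \<le> (- energy \<mu> \<mu>) * (- energy \<nu> \<nu>)"
    by (rule quadratic_nonneg_discriminant)
  then have "- energy \<mu> \<nu> \<le> energy_norm \<mu> * energy_norm \<nu>"
    unfolding energy_norm_def real_sqrt_mult[symmetric] by (rule real_le_rsqrt)
  moreover have "(energy_norm \<mu>)\<^sup>2 = - energy \<mu> \<mu>" "(energy_norm \<nu>)\<^sup>2 = - energy \<nu> \<nu>"
    and nn: "0 \<le> energy_norm \<mu>" "0 \<le> energy_norm \<nu>"
    using energy_nonpos[OF q] \<mu> \<nu> by (auto simp: energy_norm_def)
  \<comment> \<open>The factor 1 makes \<open>expand\<close> applicable with
    \<open>t = 1\<close>.\<close>
  ultimately have "- energy (\<lambda>A. \<mu> A + 1 * \<nu> A) (\<lambda>A. \<mu> A + 1 * \<nu> A) \<le> (energy_norm \<mu> + energy_norm \<nu>)\<^sup>2"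
    unfolding expand by (simp add: power2_sum)
  then have "sqrt (- energy (\<lambda>A. \<mu> A + \<nu> A) (\<lambda>A. \<mu> A + \<nu> A)) \<le> energy_norm \<mu> + energy_norm \<nu>"
    using nn by (intro real_le_lsqrt) auto
  then show ?thesis by (simp only: energy_norm_def)
qed

lemma openin_E0_unit_ball:
  assumes q: "quasihypermetric"
  shows "openin E0_topology {\<mu> \<in> \<M>\<^sub>0. energy_norm \<mu> < 1}"
  unfolding openin_E0_topology
proof (intro conjI ballI)
  fix \<mu> assume \<mu>: "\<mu> \<in> {\<mu> \<in> \<M>\<^sub>0. energy_norm \<mu> < 1}"
  show "\<exists>\<epsilon>>0. \<forall>\<nu>\<in>\<M>\<^sub>0. energy_norm (\<lambda>A. \<nu> A - \<mu> A) < \<epsilon> \<longrightarrow> \<nu> \<in> {\<mu> \<in> \<M>\<^sub>0. energy_norm \<mu> < 1}"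
  proof (intro exI[of _ "1 - energy_norm \<mu>"] conjI ballI impI)
    fix \<nu> assume \<nu>: "\<nu> \<in> \<M>\<^sub>0" "energy_norm (\<lambda>A. \<nu> A - \<mu> A) < 1 - energy_norm \<mu>"
    have "(\<lambda>A. \<nu> A - \<mu> A) \<in> \<M>\<^sub>0" using M0_add_mult[of \<nu> \<mu> "-1"] \<nu> \<mu> by simp
    from energy_norm_triangle[OF q this, of \<mu>] \<nu> \<mu>
    show "\<nu> \<in> {\<mu> \<in> \<M>\<^sub>0. energy_norm \<mu> < 1}" by simp
  qed (use \<mu> in simp)
qed auto

end

section \<open>Combinations of dipoles\<close>

text \<open>Gaussian elimination, by induction on the equations: a nonzero coefficient
  \<open>F i k0\<close> is used to eliminate the unknown \<open>k0\<close> from the remaining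
  equations.\<close>

lemma homogeneous_system_nontrivial_solution:
  fixes F :: "'i \<Rightarrow> 'k \<Rightarrow> 'c::field"
  assumes "finite I" "finite K" "card I < card K"
  shows "\<exists>c. (\<exists>k\<in>K. c k \<noteq> 0) \<and> (\<forall>i\<in>I. (\<Sum>k\<in>K. c k * F i k) = 0)"
  using assms
proof (induction I arbitrary: K F rule: finite_induct)
  case empty
  then have "K \<noteq> {}" by auto
  then show ?case by (intro exI[of _ "\<lambda>_. 1"]) auto
next
  case (insert i I)
  show ?case
  proof (cases "\<forall>k\<in>K. F i k = 0")
    case True
    have "card I < card K" using insert by simp
    from insert.IH[OF insert.prems(1) this, of F]
    obtain c where "\<exists>k\<in>K. c k \<noteq> 0" "\<And>j. j \<in> I \<Longrightarrow> (\<Sum>k\<in>K. c k * F j k) = 0" by blast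
    with True show ?thesis by (intro exI[of _ c]) simp
  next
    case False
    then obtain k0 where k0: "k0 \<in> K" "F i k0 \<noteq> 0" by blast
    have K': "finite (K - {k0})" "card I < card (K - {k0})"
      using insert k0 by simp_all
    obtain c where c: "\<exists>k\<in>K - {k0}. c k \<noteq> 0"
      "\<And>j. j \<in> I \<Longrightarrow> (\<Sum>k\<in>K - {k0}. c k * (F j k - F j k0 * F i k / F i k0)) = 0"
      using insert.IH[OF K', of "\<lambda>j k. F j k - F j k0 * F i k / F i k0"] by blast
    define S where "S = (\<Sum>k\<in>K - {k0}. c k * F i k)"
    \<comment> \<open>The eliminated unknown receives the value that solves equation
      \<open>i\<close>.\<close>
    define c' where "c' = c(k0 := - S / F i k0)"
    have expand: "(\<Sum>k\<in>K. c' k * F j k) = - S / F i k0 * F j k0 + (\<Sum>k\<in>K - {k0}. c k * F j k)" for j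
      using insert.prems(1) k0(1) by (simp add: sum.remove c'_def)
    have "(\<Sum>k\<in>K. c' k * F j k) = 0" if "j \<in> I" for j
    proof -
      have "(\<Sum>k\<in>K - {k0}. c k * (F j k - F j k0 * F i k / F i k0))
          = (\<Sum>k\<in>K - {k0}. c k * F j k - c k * F i k / F i k0 * F j k0)"
        by (simp add: right_diff_distrib ac_simps)
      also have "\<dots> = (\<Sum>k\<in>K - {k0}. c k * F j k) - S / F i k0 * F j k0"
        unfolding S_def sum_subtractf sum_divide_distrib sum_distrib_right ..
      finally have "(\<Sum>k\<in>K - {k0}. c k * (F j k - F j k0 * F i k / F i k0))
          = (\<Sum>k\<in>K - {k0}. c k * F j k) - S / F i k0 * F j k0" .
      with c(2)[OF that] expand show ?thesis by simp
    qed
    moreover have "(\<Sum>k\<in>K. c' k * F i k) = 0"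
      unfolding expand using k0(2) by (simp add: S_def)
    moreover have "\<exists>k\<in>K. c' k \<noteq> 0" using c(1) by (auto simp: c'_def)
    ultimately show ?thesis by blast
  qed
qed

text \<open>Bounds the squared weights by 1/3 in total, by which the diagonal of the Gram matrix
  will dominate the rest.\<close>

lemma sum_quarter_powers: "(\<Sum>k<m. ((1/2) ^ Suc k)\<^sup>2 :: real) = (1 - (1/4) ^ m) / 3"
proof -
  have "((1/2) ^ Suc k)\<^sup>2 = ((1/4) ^ Suc k :: real)" for k
    unfolding power2_eq_square power_mult_distrib[symmetric] by simp
  then have "(\<Sum>k<m. ((1/2) ^ Suc k)\<^sup>2 :: real) = (\<Sum>k<m. (1/4) ^ Suc k)" by (intro sum.cong) auto
  also have "\<dots> = (1 - (1/4) ^ m) / 3" by (induction m) (simp_all add: diff_divide_distrib)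
  finally show ?thesis .
qed

context compact_metric
begin

section \<open>Dipoles with a common base point\<close>

definition dipoles :: "'a \<Rightarrow> (nat \<Rightarrow> 'a) \<Rightarrow> (nat \<Rightarrow> real) \<Rightarrow> nat \<Rightarrow> 'a set \<Rightarrow> real" where
  "dipoles x p c m = (\<lambda>A. \<Sum>k<m. c k * (point_mass (p k) A + (-1) * point_mass x A))"

lemma dipole_signed: "(\<lambda>A. point_mass y A + (-1) * point_mass x A) \<in> \<M>"
  by (intro signed_measures_add_mult point_mass_signed)

lemma dipoles_M0:
  assumes "x \<in> M" "\<And>k. p k \<in> M"
  shows "dipoles x p c m \<in> \<M>\<^sub>0"
proof -
  have "M \<in> sets borel_sets" using openin_in_sets_borel_of[OF openin_topspace, of mtopology] by simp
  then have "dipoles x p c m M = 0" using assms by (simp add: dipoles_def point_mass_def)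
  moreover have "dipoles x p c m \<in> \<M>"
    unfolding dipoles_def by (intro signed_measures_sum dipole_signed)
  ultimately show ?thesis by (simp add: null_mass_measures_def)
qed

lemma signed_integral_dipole:
  assumes "x \<in> M" "y \<in> M" "continuous_map mtopology euclideanreal f"
  shows "\<I> (\<lambda>A. point_mass y A + (-1) * point_mass x A) f = f y - f x"
proof -
  \<comment> \<open>The difference is written as a sum over the booleans to bring it under
    \<open>signed_integral_sum\<close>.\<close>
  have "\<I> (\<lambda>A. \<Sum>b\<in>{True, False}. (if b then 1 else -1) * point_mass (if b then y else x) A) f
      = (\<Sum>b\<in>{True, False}. (if b then 1 else -1) * \<I> (point_mass (if b then y else x)) f)"
    by (intro signed_integral_sum assms point_mass_signed)
  then show ?thesis using assms by (simp add: signed_integral_point_mass)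
qed

lemma signed_integral_dipoles:
  assumes "x \<in> M" "\<And>k. p k \<in> M" "continuous_map mtopology euclideanreal f"
  shows "\<I> (dipoles x p c m) f = (\<Sum>k<m. c k * (f (p k) - f x))"
  unfolding dipoles_def
  by (subst signed_integral_sum[OF assms(3)])
    (use assms in \<open>simp_all add: dipole_signed[simplified] signed_integral_dipole[simplified]\<close>)

text \<open>The potential is a combination of differences of distances and is integrated against the
  same dipoles. The resulting Gram matrix consists of twice the Gromov products of
  \<open>p k\<close> and \<open>p l\<close> at \<open>x\<close>.\<close>

lemma energy_dipoles:
  assumes "x \<in> M" "\<And>k. p k \<in> M"
  shows "- energy (dipoles x p c m) (dipoles x p c m)
    = (\<Sum>k<m. \<Sum>l<m. c k * c l * (d (p k) x + d (p l) x - d (p k) (p l)))"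
proof -
  let ?\<mu> = "dipoles x p c m"
  have \<mu>: "?\<mu> \<in> \<M>" using dipoles_M0[of x p] assms M0_signed by blast
  have pot: "potential ?\<mu> y = (\<Sum>l<m. c l * (d (p l) y - d x y))" if "y \<in> M" for y
    unfolding potential_def using assms that by (intro signed_integral_dipoles continuous_map_dist)
  have "energy ?\<mu> ?\<mu> = (\<Sum>k<m. c k * (potential ?\<mu> (p k) - potential ?\<mu> x))"
    unfolding energy_eq_potential
    using assms potential_continuous[OF \<mu>] by (intro signed_integral_dipoles)
  also have "\<dots> = (\<Sum>k<m. \<Sum>l<m. c k * c l * (d (p l) (p k) - d x (p k) - d (p l) x))"
    using assms by (simp add: pot sum_distrib_left sum_subtractf[symmetric] algebra_simps)
  finally show ?thesis
    unfolding sum_negf[symmetric] by (simp add: commute algebra_simps sum_negf[symmetric])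
qed

text \<open>The Gram matrix of the dipoles \<open>\<delta>\<^bsub>p k\<^esub> - \<delta>\<^bsub>x\<^esub>\<close> has entries between 0 and
  \<open>2 min (d (p k) x) (d (p l) x)\<close>, so after normalization it is close to the identity when the
  distances \<open>d (p k) x\<close> decay fast.\<close>
lemma energy_dipoles_neg:
  assumes x: "x \<in> M" and p: "\<And>k. p k \<in> M" "\<And>k. p k \<noteq> x"
    and decay: "\<And>k l. k < l \<Longrightarrow> d (p l) x \<le> d (p k) x * (1/16) ^ Suc l"
    and c: "\<exists>k<m. c k \<noteq> 0"
  shows "energy (dipoles x p c m) (dipoles x p c m) < 0"
proof -
  define h :: "nat \<Rightarrow> real" where "h k = (1/2) ^ Suc k" for k
  define r where "r k = sqrt (d (p k) x)" for k
  define y where "y k = \<bar>c k\<bar> * r k" for k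
  have r: "0 < r k" "d (p k) x = r k * r k" for k
    using p x by (simp_all add: r_def mdist_pos_less)
  have h: "0 < h k" for k by (simp add: h_def)
  have min_bound: "d (p l) x \<le> r k * r l * (h k * h l)" if "k < l" for k l
  proof -
    \<comment> \<open>The decay rate 1/16 is the fourth power of the ratio 1/2 of the weights
      \<open>h\<close>: two factors come from \<open>h k * h l\<close>, and the square root in
      \<open>r\<close> doubles them.\<close>
    have "(1/16) ^ Suc l = (h l * h l)\<^sup>2"
      by (simp add: h_def power_mult_distrib[symmetric] power2_eq_square)
    also have "\<dots> \<le> (h k * h l)\<^sup>2"
      using that h by (intro power_mono mult_right_mono) (auto simp: h_def intro: power_decreasing less_imp_le)
    finally have "d (p l) x \<le> d (p k) x * (h k * h l)\<^sup>2"
      using decay[OF that] mult_left_mono[of _ _ "d (p k) x"] order_trans by (meson nonneg)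
    also have "\<dots> = (r k * (h k * h l))\<^sup>2" by (simp add: r power2_eq_square)
    finally have "r l \<le> r k * (h k * h l)"
      unfolding r_def[of l] using r(1)[of k] h[of k] h[of l] by (intro real_le_lsqrt) auto
    from mult_right_mono[OF this, of "r l"] r(1)[of l] show ?thesis
      by (simp add: r(2)[of l] ac_simps)
  qed
  \<comment> \<open>Off the diagonal each entry is controlled by a rank-one matrix. On the diagonal
    the subtracted square is given away, so that the rank-one part sums to a perfect square.\<close>
  have "c k * c l * (d (p k) x + d (p l) x - d (p k) (p l))
      \<ge> (if k = l then 2 * (y k)\<^sup>2 else 0) - 2 * ((y k * h k) * (y l * h l))" for k l
  proof (cases "k = l")
    case True
    have "0 \<le> (y k * h k) * (y k * h k)" by simp
    moreover have "c k * c k * (d (p k) x + d (p k) x - 0) = 2 * (y k)\<^sup>2"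
      unfolding y_def power_mult_distrib power2_abs r(2) by (simp add: power2_eq_square)
    ultimately show ?thesis unfolding True[symmetric] using p by (simp only: mdist_zero) simp
  next
    case False
    let ?G = "d (p k) x + d (p l) x - d (p k) (p l)"
    have G: "0 \<le> ?G" "?G \<le> 2 * d (p l) x" "?G \<le> 2 * d (p k) x"
      using triangle[of "p k" x "p l"] triangle[of "p k" "p l" x] triangle[of "p l" "p k" x] x p
      by (simp_all add: commute)
    have "?G \<le> 2 * (r k * r l * (h k * h l))"
      using min_bound[of k l] min_bound[of l k] G False by (cases "k < l") (auto simp: ac_simps)
    then have "\<bar>c k * c l\<bar> * ?G \<le> \<bar>c k * c l\<bar> * (2 * (r k * r l * (h k * h l)))"
      by (rule mult_left_mono) simp
    also have "\<dots> = 2 * ((y k * h k) * (y l * h l))" by (simp add: y_def abs_mult)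
    finally have "\<bar>c k * c l * ?G\<bar> \<le> 2 * ((y k * h k) * (y l * h l))"
      using G(1) by (simp add: abs_mult)
    then show ?thesis using False by simp
  qed
  then have "(\<Sum>k<m. \<Sum>l<m. (if k = l then 2 * (y k)\<^sup>2 else 0) - 2 * ((y k * h k) * (y l * h l)))
      \<le> - energy (dipoles x p c m) (dipoles x p c m)"
    unfolding energy_dipoles[of x p, OF x p(1)] by (intro sum_mono) auto
  moreover have "(\<Sum>k<m. \<Sum>l<m. (if k = l then 2 * (y k)\<^sup>2 else 0) - 2 * ((y k * h k) * (y l * h l)))
      = 2 * (\<Sum>k<m. (y k)\<^sup>2) - 2 * (\<Sum>k<m. y k * h k)\<^sup>2"
    unfolding sum_subtractf power2_eq_square[of "\<Sum>k<m. y k * h k"] sum_product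
    by (simp add: sum_distrib_left)
  moreover have "(\<Sum>k<m. y k * h k)\<^sup>2 < (\<Sum>k<m. (y k)\<^sup>2)"
  proof -
    \<comment> \<open>Cauchy-Schwarz gives the factor 1/3; strictness then needs only one nonzero
      \<open>c k\<close>.\<close>
    have "(\<Sum>k<m. y k * h k)\<^sup>2 \<le> (\<Sum>k<m. (y k)\<^sup>2) * (\<Sum>k<m. (h k)\<^sup>2)"
      by (rule Cauchy_Schwarz_ineq_sum)
    also have "(\<Sum>k<m. (h k)\<^sup>2) \<le> 1/3"
      unfolding h_def sum_quarter_powers by simp
    also have "(\<Sum>k<m. (y k)\<^sup>2) * (1/3) < (\<Sum>k<m. (y k)\<^sup>2)"
    proof -
      obtain k where "k < m" "c k \<noteq> 0" using c by blast
      then have "0 < (\<Sum>k<m. (y k)\<^sup>2)"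
        using r(1)[of k] by (intro sum_pos2[of _ k]) (auto simp: y_def)
      then show ?thesis by simp
    qed
    finally show ?thesis by (simp add: mult_left_mono sum_nonneg)
  qed
  ultimately show ?thesis by simp
qed

section \<open>Incomparability\<close>

text \<open>Induction over the generation of \<open>W\<close>: a subbasic set around 0 contains the
  kernel of its own functional, an intersection takes the union of the two finite sets of
  functionals, and a union takes those of one member containing 0.\<close>

lemma openin_weak_star_contains_finite_codimension:
  assumes "openin (weak_star mtopology) W" "(\<lambda>_. 0) \<in> W"
  obtains F where "finite F" "\<And>f. f \<in> F \<Longrightarrow> continuous_map mtopology euclideanreal f"
    "\<And>\<mu>. \<mu> \<in> \<M> \<Longrightarrow> (\<And>f. f \<in> F \<Longrightarrow> \<I> \<mu> f = 0) \<Longrightarrow> \<mu> \<in> W"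
proof -
  let ?P = "\<lambda>W F. finite F \<and> (\<forall>f\<in>F. continuous_map mtopology euclideanreal f)
    \<and> (\<forall>\<mu>\<in>\<M>. (\<forall>f\<in>F. \<I> \<mu> f = 0) \<longrightarrow> \<mu> \<in> W)"
  have "generate_topology_on {{\<mu> \<in> \<M>. \<I> \<mu> f \<in> U} | f U.
        continuous_map mtopology euclideanreal f \<and> open U} W"
    using assms(1) unfolding weak_star_def openin_topology_generated_by_iff .
  then have "(\<lambda>_. 0) \<in> W \<longrightarrow> (\<exists>F. ?P W F)"
  proof induction
    case Empty then show ?case by simp
  next
    case (Int a b)
    show ?case
    proof
      assume "(\<lambda>_. 0) \<in> a \<inter> b"
      with Int obtain F G where "?P a F" "?P b G" by blast
      then have "?P (a \<inter> b) (F \<union> G)" by (simp add: ball_Un)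
      then show "\<exists>F. ?P (a \<inter> b) F" by blast
    qed
  next
    case (UN K)
    show ?case
    proof
      assume "(\<lambda>_. 0) \<in> \<Union>K"
      then obtain k where k: "k \<in> K" "(\<lambda>_. 0) \<in> k" by blast
      then obtain F where F: "?P k F" using UN.IH[OF k(1)] by (elim impE exE)
      then have "?P (\<Union>K) F" using k(1) by (meson UnionI)
      then show "\<exists>F. ?P (\<Union>K) F" by (rule exI)
    qed
  next
    case (Basis s)
    then obtain f U where s: "s = {\<mu> \<in> \<M>. \<I> \<mu> f \<in> U}"
      and f: "continuous_map mtopology euclideanreal f" by blast
    have "\<I> (\<lambda>_. 0) f = 0" by (simp add: signed_integral_def)
    then have "?P s {f}" if "(\<lambda>_. 0) \<in> s" using that f by (auto simp: s)
    then show ?case by blast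
  qed
  then obtain F where F: "?P W F" using assms(2) by (elim impE exE)
  show ?thesis by (rule that[of F]) (use F in simp_all)
qed

lemma zero_M0: "(\<lambda>_. 0) \<in> \<M>\<^sub>0"
  by (simp add: null_mass_measures_def signed_measures_def)

section \<open>Fast convergence to an accumulation point\<close>

lemma accumulation_point:
  assumes "infinite M"
  obtains x where "x \<in> M" "\<And>r. r > 0 \<Longrightarrow> \<exists>y\<in>M. y \<noteq> x \<and> d y x < r"
proof -
  have "M \<inter> mtopology derived_set_of M \<noteq> {}"
    using compact_M assms compactin_eq_Bolzano_Weierstrass[of M]
    by (auto simp: compact_space_def)
  then obtain x where x: "x \<in> M" "x \<in> mtopology derived_set_of M" by blast
  then have "\<exists>y\<in>M. y \<noteq> x \<and> d y x < r" if "r > 0" for r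
    using that unfolding metric_derived_set_of by (auto simp: commute)
  with x that show ?thesis by blast
qed

text \<open>Each point is chosen close to \<open>x\<close> relative to its predecessor. Since the
  distances to \<open>x\<close> decrease, the bound against the predecessor carries over to all
  earlier points.\<close>

lemma decaying_sequence:
  assumes x: "x \<in> M" and acc: "\<And>r. r > 0 \<Longrightarrow> \<exists>y\<in>M. y \<noteq> x \<and> d y x < r"
  obtains p where "\<And>k::nat. p k \<in> M" "\<And>k. p k \<noteq> x"
    "\<And>k l. k < l \<Longrightarrow> d (p l) x \<le> d (p k) x * (1/16) ^ Suc l"
proof -
  \<comment> \<open>The exponent \<open>Suc (Suc k)\<close> is \<open>Suc l\<close> for the later
    index \<open>l = Suc k\<close>.\<close>
  have "\<exists>p. \<forall>k. (p k \<in> M \<and> p k \<noteq> x) \<and> d (p (Suc k)) x \<le> d (p k) x * (1/16) ^ Suc (Suc k)"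
  proof (rule dependent_nat_choice)
    show "\<exists>y. y \<in> M \<and> y \<noteq> x" using acc[of 1] by auto
  next
    fix y k assume "y \<in> M \<and> y \<noteq> x"
    then have "0 < d y x * (1/16) ^ Suc (Suc k)" using x by (simp add: mdist_pos_less)
    from acc[OF this] show "\<exists>z. (z \<in> M \<and> z \<noteq> x) \<and> d z x \<le> d y x * (1/16) ^ Suc (Suc k)"
      by (meson less_imp_le)
  qed
  then obtain p where p: "\<And>k. p k \<in> M" "\<And>k. p k \<noteq> x"
    and step: "\<And>k. d (p (Suc k)) x \<le> d (p k) x * (1/16) ^ Suc (Suc k)" by blast
  have "d (p (Suc k)) x \<le> d (p k) x" for k
    using step[of k] mult_left_mono[OF power_le_one[of "1/16::real" "Suc (Suc k)"], of "d (p k) x"]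
    by simp
  then have anti: "d (p l) x \<le> d (p k) x" if "k \<le> l" for k l
    using lift_Suc_antimono_le[of "\<lambda>k. d (p k) x"] that by blast
  have "d (p l) x \<le> d (p k) x * (1/16) ^ Suc l" if kl: "k < l" for k l
  proof -
    obtain l' where l': "l = Suc l'" "k \<le> l'" using kl by (cases l) auto
    have "d (p l) x \<le> d (p l') x * (1/16) ^ Suc l" using step[of l'] l' by simp
    also have "\<dots> \<le> d (p k) x * (1/16) ^ Suc l" using anti[OF l'(2)] by (intro mult_right_mono) auto
    finally show ?thesis .
  qed
  with p that show ?thesis by blast
qed

section \<open>The two separating open sets\<close>

lemma E0_unit_ball_not_weak_star_open:
  assumes q: "quasihypermetric" and inf: "infinite M"
  shows "\<not> openin weak_star_M0 {\<mu> \<in> \<M>\<^sub>0. energy_norm \<mu> < 1}"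
proof
  assume "openin weak_star_M0 {\<mu> \<in> \<M>\<^sub>0. energy_norm \<mu> < 1}"
  then obtain W where W: "openin (weak_star mtopology) W"
    "{\<mu> \<in> \<M>\<^sub>0. energy_norm \<mu> < 1} = W \<inter> \<M>\<^sub>0"
    unfolding weak_star_M0_def openin_subtopology by blast
  have "energy_norm (\<lambda>_. 0) = 0"
    by (simp add: energy_norm_def energy_def signed_integral_def)
  then have "(\<lambda>_. 0) \<in> {\<mu> \<in> \<M>\<^sub>0. energy_norm \<mu> < 1}" using zero_M0 by simp
  then have "(\<lambda>_. 0) \<in> W" unfolding W(2) by (rule IntD1)
  then obtain F where F: "finite F" "\<And>f. f \<in> F \<Longrightarrow> continuous_map mtopology euclideanreal f"
    "\<And>\<mu>. \<mu> \<in> \<M> \<Longrightarrow> (\<And>f. f \<in> F \<Longrightarrow> \<I> \<mu> f = 0) \<Longrightarrow> \<mu> \<in> W"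
    using openin_weak_star_contains_finite_codimension[OF W(1)] by blast
  obtain x where x: "x \<in> M" and acc: "\<And>r. r > 0 \<Longrightarrow> \<exists>y\<in>M. y \<noteq> x \<and> d y x < r"
    using accumulation_point[OF inf] by blast
  obtain p where p: "\<And>k::nat. p k \<in> M" "\<And>k. p k \<noteq> x"
    and decay: "\<And>k l. k < l \<Longrightarrow> d (p l) x \<le> d (p k) x * (1/16) ^ Suc l"
    using decaying_sequence[OF x acc] by blast
  \<comment> \<open>One dipole more than there are functionals, so some nontrivial combination is
    annihilated by all of them.\<close>
  let ?m = "Suc (card F)"
  obtain c where c: "\<exists>k<?m. c k \<noteq> 0" "\<And>f. f \<in> F \<Longrightarrow> (\<Sum>k<?m. c k * (f (p k) - f x)) = 0"
    using homogeneous_system_nontrivial_solution[OF F(1) finite_lessThan[of ?m], of "\<lambda>f k. f (p k) - f x"]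
    unfolding card_lessThan by (metis lessI lessThan_iff)
  define Q where "Q = - energy (dipoles x p c ?m) (dipoles x p c ?m)"
  have Q: "Q > 0" using energy_dipoles_neg[OF x p decay c(1)] by (simp add: Q_def)
  \<comment> \<open>Rescaled to energy norm exactly 1. All functionals in \<open>F\<close> still
    vanish on it, so it lies in \<open>W\<close>, and yet it is outside the open unit ball.\<close>
  define \<mu> where "\<mu> = dipoles x p (\<lambda>k. c k / sqrt Q) ?m"
  have \<mu>: "\<mu> \<in> \<M>\<^sub>0" unfolding \<mu>_def using x p(1) by (rule dipoles_M0)
  have "\<I> \<mu> f = 0" if "f \<in> F" for f
  proof -
    have "\<I> \<mu> f = (\<Sum>k<?m. c k * (f (p k) - f x)) / sqrt Q"
      unfolding \<mu>_def signed_integral_dipoles[of x p, OF x p(1) F(2)[OF that]] sum_divide_distrib by simp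
    with c(2)[OF that] show ?thesis by simp
  qed
  with F(3) M0_signed[OF \<mu>] \<mu> W(2) have "energy_norm \<mu> < 1" by blast
  moreover have "- energy \<mu> \<mu> = Q / (sqrt Q * sqrt Q)"
    unfolding \<mu>_def Q_def energy_dipoles[of x p, OF x p(1)] sum_divide_distrib by simp
  ultimately show False using Q by (simp add: energy_norm_def)
qed

lemma weak_star_open_not_E0_open:
  assumes inf: "infinite M"
  obtains U where "openin weak_star_M0 U" "\<not> openin E0_topology U"
proof -
  obtain x where x: "x \<in> M" and acc: "\<And>r. r > 0 \<Longrightarrow> \<exists>y\<in>M. y \<noteq> x \<and> d y x < r"
    using accumulation_point[OF inf] by blast
  \<comment> \<open>The fourth root of the distance to \<open>x\<close>: its growth at
    \<open>x\<close> lies below the square root that governs the energy norm of a dipole.\<close>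
  define f where "f y = sqrt (sqrt (d y x))" for y
  have f: "continuous_map mtopology euclideanreal f"
    unfolding f_def by (intro continuous_map_sqrt continuous_map_dist x)
  define W where "W = {\<mu> \<in> \<M>. \<I> \<mu> f \<in> {..<1}}"
  have "openin (weak_star mtopology) W"
    unfolding weak_star_def W_def using f open_lessThan[of "1::real"]
    by (intro topology_generated_by_Basis) blast
  then have "openin weak_star_M0 (W \<inter> \<M>\<^sub>0)"
    unfolding weak_star_M0_def openin_subtopology by blast
  moreover have "\<not> openin E0_topology (W \<inter> \<M>\<^sub>0)"
  proof
    assume "openin E0_topology (W \<inter> \<M>\<^sub>0)"
    moreover have "(\<lambda>_. 0) \<in> W \<inter> \<M>\<^sub>0"
      using zero_M0 M0_signed by (simp add: W_def signed_integral_def)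
    ultimately obtain \<epsilon> where \<epsilon>: "\<epsilon> > 0" "\<And>\<nu>. \<nu> \<in> \<M>\<^sub>0 \<Longrightarrow> energy_norm \<nu> < \<epsilon> \<Longrightarrow> \<nu> \<in> W"
      unfolding openin_E0_topology by (auto dest: bspec[of _ _ "\<lambda>_. 0"])
    \<comment> \<open>The radius is chosen so that
      \<open>2 * sqrt (d y x) < \<epsilon>\<^sup>2\<close>, the left side being the squared energy
      norm of the \<open>\<nu>\<close> below.\<close>
    obtain y where y: "y \<in> M" "y \<noteq> x" "d y x < (\<epsilon>\<^sup>2 / 2)\<^sup>2"
      using acc[of "(\<epsilon>\<^sup>2 / 2)\<^sup>2"] \<epsilon>(1) by auto
    have pos: "0 < d y x" using x y by (simp add: mdist_pos_less)
    \<comment> \<open>The factor \<open>1 / f y\<close> makes the integral of \<open>f\<close> equal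
      to 1, as \<open>f x = 0\<close>, and this value is just excluded by \<open>W\<close>.\<close>
    define \<nu> where "\<nu> = dipoles x (\<lambda>_. y) (\<lambda>_. 1 / f y) 1"
    have \<nu>: "\<nu> \<in> \<M>\<^sub>0" unfolding \<nu>_def using x y by (intro dipoles_M0)
    have "- energy \<nu> \<nu> = 2 * d y x / sqrt (d y x)"
      unfolding \<nu>_def using energy_dipoles[of x "\<lambda>_. y" "\<lambda>_. 1 / f y" 1] x y pos by (simp add: f_def)
    also have "\<dots> = 2 * sqrt (d y x)" using pos by (simp add: real_div_sqrt flip: times_divide_eq_right)
    also have "sqrt (d y x) < \<epsilon>\<^sup>2 / 2" using y(3) by (intro real_less_lsqrt) auto
    finally have "energy_norm \<nu> < \<epsilon>"
      unfolding energy_norm_def using \<epsilon>(1) by (intro real_less_lsqrt) auto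
    then have "\<nu> \<in> W" using \<epsilon>(2) \<nu> by blast
    moreover have "\<I> \<nu> f = 1"
      unfolding \<nu>_def using signed_integral_dipoles[of x "\<lambda>_. y" f "\<lambda>_. 1 / f y" 1] x y pos f
      by (simp add: f_def)
    ultimately show False by (simp add: W_def)
  qed
  ultimately show ?thesis by (rule that)
qed

end

theorem theorem4p8:
  fixes X :: "'a set" and d :: "'a \<Rightarrow> 'a \<Rightarrow> real"
  assumes "Metric_space X d"
    and "compact_space (Metric_space.mtopology X d)"
    and "Metric_space.quasihypermetric X d"
    and "infinite X"
  shows "\<not> (\<forall>U. openin (Metric_space.E0_topology X d) U \<longrightarrow>
               openin (Metric_space.weak_star_M0 X d) U) \<and>
         \<not> (\<forall>U. openin (Metric_space.weak_star_M0 X d) U \<longrightarrow>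
               openin (Metric_space.E0_topology X d) U)"
proof -
  interpret Metric_space X d by fact
  interpret compact_metric X d by unfold_locales fact
  show ?thesis
    using openin_E0_unit_ball E0_unit_ball_not_weak_star_open weak_star_open_not_E0_open assms(3,4) by metis
qed

end
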